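(* Let $A_0,A_0'$ be any two clusters in $\Omega$ with $|A_0|=|A_0'|$ and define $h_0=\max\{h(A_0),h(A_0')\}$. Assume that $h_0\leq N^m$ for some fixed $m\in\mathbb{N}$. Let $(A(t))_{t\ge0}$ and $(A'(t))_{t\ge0}$ be two IDLA processes starting from $A_0,A_0'$ and denote the laws of $A(t),A'(t)$ by $P(t),P'(t)$ respectively. Then for any $\gamma>0$ there exists a constant $d'_{\gamma,m}$, depending only on $\gamma$ and $m$, such that for $$t_{\gamma,m}=h_0N+d'_{\gamma,m}N^2\log N$$ and $N$ large enough, it holds $$\|P(t_{\gamma,m})-P'(t_{\gamma,m})\|_{TV}\leq N^{-\gamma}.$$
   Context: For an integer $N\ge 3$, $\mathbb{Z}_N\times\mathbb{Z}$ is the cylinder graph whose base graph is the cycle on $N$ vertices; level $k$ is $\mathbb{Z}_N\times\{k\}$ and $R_k=\{(x,y)\in\mathbb{Z}_N\times\mathbb{Z}: y\leq k\}$. Internal DLA (IDLA): the state space is $\Omega=\{A\subseteq\mathbb{Z}_N\times\mathbb{Z}: A=R_0\cup F\text{ for some finite }F\}$. Given $A(0)\in\Omega$, for integers $t\ge1$ set $A(t)=A(t-1)\cup\{Z_t\}$, where $Z_t$ is the exit location from $A(t-1)$ (the first site visited outside $A(t-1)$) of a simple random walk on the cylinder graph started from a uniformly random site of level $0$, independent of the past. For non-integer $t\ge0$ read $A(t)=A(\lfloor t\rfloor)$. For $A\in\Omega$, $|A|=\#\{(x,y)\in A:y>0\}$ is the number of sites of $A$ strictly above level $0$, and $h(A)=\max\{y:(x,y)\in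 A\text{ for some }x\in\mathbb{Z}_N\}$ is its height. $\|P-Q\|_{TV}=\sup_{S}|P(S)-Q(S)|$ is total variation distance. *)

theory Defs
  imports "HOL-Probability.Probability"
begin

type_synonym site = "int \<times> int"

definition cyl :: "nat \<Rightarrow> site set" where
  "cyl N = {0..<int N} \<times> UNIV"

definition level :: "nat \<Rightarrow> int \<Rightarrow> site set" where
  "level N k = {0..<int N} \<times> {k}"

definition Rle :: "nat \<Rightarrow> int \<Rightarrow> site set" where
  "Rle N k = {(x, y) \<in> cyl N. y \<le> k}"

definition cycle_adj :: "nat \<Rightarrow> int \<Rightarrow> int \<Rightarrow> bool" where
  "cycle_adj N x x' \<longleftrightarrow> x' = (x + 1) mod int N \<or> x = (x' + 1) mod int N"

definition nbrs :: "nat \<Rightarrow> site \<Rightarrow> site set" where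
  "nbrs N v = {w \<in> cyl N. snd v = snd w \<and> cycle_adj N (fst v) (fst w)
                 \<or> fst v = fst w \<and> \<bar>snd v - snd w\<bar> = 1}"

definition Omega :: "nat \<Rightarrow> site set set" where
  "Omega N = {A. \<exists>F. finite F \<and> F \<subseteq> cyl N \<and> A = Rle N 0 \<union> F}"

definition cluster_size :: "site set \<Rightarrow> nat" where
  "cluster_size A = card {(x, y) \<in> A. y > 0}"

text \<open>\<^const>\<open>Max\<close> is not usable here: a cluster has no lowest level, so its set of levels is infinite.\<close>
definition cluster_height :: "site set \<Rightarrow> int" where
  "cluster_height A = (GREATEST y. \<exists>x. (x, y) \<in> A)"

text \<open>Simple random walk is driven by i.i.d. uniform directions; the lemma \<open>distr_move\<close>
  below shows that each step then goes to a uniformly chosen neighbour.\<close>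
definition dirs :: "site set" where
  "dirs = {(1, 0), (-1, 0), (0, 1), (0, -1)}"

definition move :: "nat \<Rightarrow> site \<Rightarrow> site \<Rightarrow> site" where
  "move N v e = ((fst v + fst e) mod int N, snd v + snd e)"

text \<open>A sample point of a walk is its starting site together with its stream of directions.\<close>
type_synonym walk = "site \<times> site stream"

definition walk_space :: "nat \<Rightarrow> walk measure" where
  "walk_space N =
     uniform_count_measure (level N 0) \<Otimes>\<^sub>M stream_space (uniform_count_measure dirs)"

primrec srw :: "nat \<Rightarrow> walk \<Rightarrow> nat \<Rightarrow> site" where
  "srw N w 0 = fst w"
| "srw N w (Suc n) = move N (srw N w n) (snd w !! n)"

text \<open>On the null event that \<open>s\<close> never leaves \<open>A\<close>, the value is some site of \<open>A\<close>, so that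
  adding it does not change the cluster.\<close>
definition exit_site :: "site set \<Rightarrow> (nat \<Rightarrow> site) \<Rightarrow> site" where
  "exit_site A s = s (LEAST n. s n \<notin> A)"

text \<open>The \<open>t\<close>-th particle follows the \<open>t\<close>-th of an i.i.d. stream of walks (indexed from 0).\<close>
primrec idla :: "nat \<Rightarrow> site set \<Rightarrow> walk stream \<Rightarrow> nat \<Rightarrow> site set" where
  "idla N A0 W 0 = A0"
| "idla N A0 W (Suc t) = insert (exit_site (idla N A0 W t) (srw N (W !! t))) (idla N A0 W t)"

definition idla_law :: "nat \<Rightarrow> site set \<Rightarrow> real \<Rightarrow> site set measure" where
  "idla_law N A0 t =
     distr (stream_space (walk_space N)) (count_space (Omega N)) (\<lambda>W. idla N A0 W (nat \<lfloor>t\<rfloor>))"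

definition tv_dist :: "'a measure \<Rightarrow> 'a measure \<Rightarrow> real" where
  "tv_dist P Q = (SUP S\<in>sets P. \<bar>measure P S - measure Q S\<bar>)"

subsection \<open>Well-definedness\<close>

lemma cyl_move: "N \<ge> 3 \<Longrightarrow> move N v e \<in> cyl N"
  by (auto simp: move_def cyl_def)

lemma nbrs_eq_move:
  assumes "N \<ge> 3" "v \<in> cyl N"
  shows "nbrs N v = move N v ` dirs"
proof -
  obtain x y where v: "v = (x, y)" by force
  have x: "0 \<le> x" "x < int N" using assms v by (auto simp: cyl_def)
  have a: "(x + 1) mod int N = (if x = int N - 1 then 0 else x + 1)" using x by auto
  have b: "(x - 1) mod int N = (if x = 0 then int N - 1 else x - 1)" 
    using x by (auto simp: zmod_minus1)
  have c: "x = (x' + 1) mod int N \<longleftrightarrow> x' = (x - 1) mod int N" if "0 \<le> x'" "x' < int N" for x'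
  proof -
    have "(x' + 1) mod int N = (if x' = int N - 1 then 0 else x' + 1)" using that by auto
    then show ?thesis using x that b by auto
  qed
  show ?thesis
  proof (intro set_eqI iffI)
    fix w assume w: "w \<in> nbrs N v"
    obtain x' y' where w': "w = (x', y')" by force
    have x': "0 \<le> x'" "x' < int N" using w w' by (auto simp: nbrs_def cyl_def)
    show "w \<in> move N v ` dirs"
      using w x x' c[OF x'] unfolding v w' nbrs_def cycle_adj_def dirs_def move_def
      by (auto simp: abs_if split: if_splits)
  next
    fix w assume "w \<in> move N v ` dirs"
    then show "w \<in> nbrs N v"
      using x c[of "(x - 1) mod int N"] assms(1) unfolding v nbrs_def cycle_adj_def dirs_def move_def cyl_def
      by auto
  qed
qed

lemma inj_on_move:
  assumes "N \<ge> 3" "v \<in> cyl N"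
  shows "inj_on (move N v) dirs"
proof -
  obtain x y where v: "v = (x, y)" by force
  have x: "0 \<le> x" "x < int N" using assms v by (auto simp: cyl_def)
  have a: "(x + 1) mod int N = (if x = int N - 1 then 0 else x + 1)" using x by auto
  have b: "(x - 1) mod int N = (if x = 0 then int N - 1 else x - 1)" 
    using x by (auto simp: zmod_minus1)
  show ?thesis using x a b assms(1) unfolding v
    by (auto simp: inj_on_def dirs_def move_def split: if_splits)
qed

lemma finite_dirs: "finite dirs" "dirs \<noteq> {}"
  by (auto simp: dirs_def)

lemma distr_move:
  assumes "N \<ge> 3" "v \<in> cyl N"
  shows "distr (uniform_count_measure dirs) (count_space (nbrs N v)) (move N v)
           = uniform_count_measure (nbrs N v)"
proof -
  have bij: "bij_betw (move N v) dirs (nbrs N v)"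
    using inj_on_move[OF assms] nbrs_eq_move[OF assms] by (simp add: bij_betw_def)
  show ?thesis
  proof (rule measure_eqI)
    fix X assume "X \<in> sets (distr (uniform_count_measure dirs) (count_space (nbrs N v)) (move N v))"
    then have X: "X \<subseteq> nbrs N v" by simp
    have m: "move N v \<in> uniform_count_measure dirs \<rightarrow>\<^sub>M count_space (nbrs N v)"
      using bij by (auto simp: measurable_def space_uniform_count_measure sets_uniform_count_measure bij_betw_def)
    have "bij_betw (move N v) (move N v -` X \<inter> dirs) X"
    proof (rule bij_betw_imageI)
      show "inj_on (move N v) (move N v -` X \<inter> dirs)"
        using bij inj_on_subset[of "move N v" dirs] by (simp add: bij_betw_def)
      have "X \<subseteq> move N v ` dirs" using bij X by (simp add: bij_betw_def)
      then show "move N v ` (move N v -` X \<inter> dirs) = X" by blast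
    qed
    then have "card (move N v -` X \<inter> dirs) = card X" by (rule bij_betw_same_card)
    moreover have "card dirs = card (nbrs N v)" "finite (nbrs N v)"
      using bij_betw_same_card[OF bij] bij_betw_finite[OF bij] finite_dirs by simp_all
    ultimately show "emeasure (distr (uniform_count_measure dirs) (count_space (nbrs N v)) (move N v)) X
        = emeasure (uniform_count_measure (nbrs N v)) X"
      using X emeasure_distr[OF m, of X] finite_dirs(1)
      by (simp add: emeasure_uniform_count_measure space_uniform_count_measure)
  qed (simp add: sets_uniform_count_measure)
qed

lemma level_0:
  assumes "N \<ge> 3"
  shows "finite (level N 0)" "level N 0 \<noteq> {}" "level N 0 \<subseteq> Rle N 0"
  using assms by (auto simp: level_def Rle_def cyl_def)

lemma cluster_height_Omega:
  assumes "N \<ge> 3" "A \<in> Omega N"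
  shows "\<exists>x. (x, cluster_height A) \<in> A" "(x, y) \<in> A \<Longrightarrow> y \<le> cluster_height A" "cluster_height A \<ge> 0"
proof -
  obtain F where F: "finite F" "A = Rle N 0 \<union> F" using assms by (auto simp: Omega_def)
  define T where "T = insert 0 (snd ` F)"
  have T: "finite T" using F by (auto simp: T_def)
  have z: "(0, 0) \<in> A" using assms(1) F by (auto simp: Rle_def cyl_def)
  have le: "y \<le> Max T" if "(x, y) \<in> A" for x y
  proof (cases "(x, y) \<in> F")
    case True
    then show ?thesis using T by (intro Max_ge) (auto simp: T_def image_iff intro: bexI[of _ "(x, y)"])
  next
    case False
    then have "y \<le> 0" using that F by (auto simp: Rle_def)
    moreover have "0 \<le> Max T" using T by (intro Max_ge) (auto simp: T_def)
    ultimately show ?thesis by simp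
  qed
  have "Max T \<in> T" using T by (intro Max_in) (auto simp: T_def)
  then have ex: "\<exists>x. (x, Max T) \<in> A" using z F by (auto simp: T_def)
  have h: "cluster_height A = Max T" unfolding cluster_height_def using ex le by (intro Greatest_equality) auto
  show "\<exists>x. (x, cluster_height A) \<in> A" "(x, y) \<in> A \<Longrightarrow> y \<le> cluster_height A" "cluster_height A \<ge> 0"
    using ex le z h by auto
qed

lemma finite_above_0:
  assumes "A \<in> Omega N"
  shows "finite {(x, y) \<in> A. y > 0}"
proof -
  obtain F where "finite F" "A = Rle N 0 \<union> F" using assms by (auto simp: Omega_def)
  moreover from this have "{(x, y) \<in> A. y > 0} \<subseteq> F" by (auto simp: Rle_def)
  ultimately show ?thesis by (blast intro: finite_subset)
qed

lemma srw_in_cyl: "N \<ge> 3 \<Longrightarrow> fst w \<in> cyl N \<Longrightarrow> srw N w n \<in> cyl N"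
  by (cases n) (auto simp: cyl_move)

lemma insert_Omega: "A \<in> Omega N \<Longrightarrow> z \<in> cyl N \<Longrightarrow> insert z A \<in> Omega N"
proof -
  assume "A \<in> Omega N" and z: "z \<in> cyl N"
  then obtain F where "finite F" "F \<subseteq> cyl N" "A = Rle N 0 \<union> F" by (auto simp: Omega_def)
  with z show ?thesis unfolding Omega_def by (intro CollectI exI[of _ "insert z F"]) auto
qed

lemma countable_Omega: "countable (Omega N)"
proof -
  have "countable {F :: site set. finite F}" by (rule countable_Collect_finite)
  then have "countable ((\<lambda>F. Rle N 0 \<union> F) ` {F. finite F})" by (rule countable_image)
  then show ?thesis by (rule countable_subset[rotated]) (auto simp: Omega_def)
qed

lemma prob_space_walk_space:
  assumes "N \<ge> 3"
  shows "prob_space (walk_space N)"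
  unfolding walk_space_def using level_0[OF assms] finite_dirs
  by (intro prob_space_pair prob_space.prob_space_stream_space prob_space_uniform_count_measure)

lemma space_walk_space: "w \<in> space (walk_space N) \<Longrightarrow> fst w \<in> level N 0"
  by (auto simp: walk_space_def space_pair_measure space_uniform_count_measure)

lemma measurable_srw [measurable]: "(\<lambda>w. srw N w n) \<in> walk_space N \<rightarrow>\<^sub>M count_space UNIV"
proof (induction n)
  case 0
  show ?case unfolding walk_space_def srw.simps
    by (rule measurable_compose[OF measurable_fst]) (simp add: measurable_def space_uniform_count_measure)
next
  case (Suc n)
  note [measurable] = Suc
  have [measurable]: "(\<lambda>w. snd w !! n) \<in> walk_space N \<rightarrow>\<^sub>M count_space UNIV"
    unfolding walk_space_def
    by (rule measurable_compose[OF measurable_snd], rule measurable_compose[OF measurable_snth])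
       (simp add: measurable_def space_uniform_count_measure)
  show ?case unfolding srw.simps by measurable
qed

lemma exit_site_in_cyl:
  assumes "N \<ge> 3" "w \<in> space (walk_space N)"
  shows "exit_site A (srw N w) \<in> cyl N"
  unfolding exit_site_def using assms space_walk_space[OF assms(2)]
  by (intro srw_in_cyl) (auto simp: level_def cyl_def)

lemma measurable_exit_site [measurable]:
  "(\<lambda>w. exit_site A (srw N w)) \<in> walk_space N \<rightarrow>\<^sub>M count_space UNIV"
  unfolding exit_site_def by measurable

lemma idla_in_Omega:
  assumes "N \<ge> 3" "A0 \<in> Omega N" "W \<in> space (stream_space (walk_space N))"
  shows "idla N A0 W t \<in> Omega N"
proof (induction t)
  case (Suc t)
  have "W !! t \<in> space (walk_space N)"
    using assms(3) by (auto simp: space_stream_space streams_iff_snth)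
  then show ?case using Suc exit_site_in_cyl[OF assms(1)] by (simp add: insert_Omega)
qed (use assms in simp)

lemma measurable_idla:
  assumes "N \<ge> 3" "A0 \<in> Omega N"
  shows "(\<lambda>W. idla N A0 W t) \<in> stream_space (walk_space N) \<rightarrow>\<^sub>M count_space (Omega N)"
proof (induction t)
  case 0
  then show ?case using assms by simp
next
  case (Suc t)
  let ?M = "stream_space (walk_space N)"
  have "(\<lambda>W. insert (exit_site A (srw N (W !! t))) A) \<in> ?M \<rightarrow>\<^sub>M count_space (Omega N)"
    if A: "A \<in> Omega N" for A
  proof (rule measurable_count_space_extend[OF subset_UNIV])
    show "(\<lambda>W. insert (exit_site A (srw N (W !! t))) A) \<in> space ?M \<rightarrow> Omega N"
      using A exit_site_in_cyl[OF assms(1)]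
      by (simp add: space_stream_space streams_iff_snth insert_Omega)
    have [measurable]: "(\<lambda>W. exit_site A (srw N (W !! t))) \<in> ?M \<rightarrow>\<^sub>M count_space UNIV"
      by (rule measurable_compose[OF measurable_snth measurable_exit_site])
    show "(\<lambda>W. insert (exit_site A (srw N (W !! t))) A) \<in> ?M \<rightarrow>\<^sub>M count_space UNIV"
      by measurable
  qed
  from measurable_compose_countable'[OF this Suc countable_Omega] show ?case by simp
qed

lemma prob_space_idla_law:
  assumes "N \<ge> 3" "A0 \<in> Omega N"
  shows "prob_space (idla_law N A0 t)"
  unfolding idla_law_def using assms
  by (intro prob_space.prob_space_distr prob_space.prob_space_stream_space
        prob_space_walk_space measurable_idla)

end

theory Submission
  imports Defs
begin

text \<open>
  Adding particles commutes in law (the abelian property), so the cluster reached from \<open>A0\<close> after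
  \<open>t\<close> steps has the law of the following: run \<open>t\<close> steps from the flat cluster \<open>R\<^sub>0\<close>, then release one
  particle from every site of \<open>A0\<close> above level 0. With high probability the flat process fills
  \<open>R\<^sub>H\<close> for some \<open>H \<ge> h0 + c N log N\<close>. A particle released at height at most \<open>h0\<close> then forgets its
  starting point before leaving \<open>R\<^sub>H\<close>, up to a polynomially small error, and one exchanges the particles
  of \<open>A0\<close> for those of \<open>A0'\<close> one at a time.

  To show that a site \<open>z\<close> at level \<open>k \<le> H\<close> gets filled, let \<open>\<phi>(v)\<close> be the probability that the walk from
  \<open>v\<close> hits \<open>z\<close> before level \<open>k + 1\<close>, and \<open>p\<close> its common average on all levels up to \<open>k\<close>. While \<open>z\<close> is empty,
  a particle settling at \<open>v\<close> contributes \<open>D = p - \<phi>(v)\<close> with mean at most 0, so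
  \<open>exp (\<Sum> D / 4 - D\<^sup>2 / 8)\<close> is a supermartingale. Particles settling above level \<open>k\<close>
  contribute \<open>D = p\<close>, while the total \<open>|D|\<close> over levels up to \<open>k\<close> is \<open>O(p N\<^sup>2 log N)\<close> by mixing; with
  an excess of order \<open>N\<^sup>2 log N\<close> particles the exponent is therefore large.
\<close>

section \<open>Exit laws\<close>

text \<open>One-step transition operator of the walk: \<open>f v = mean_nbrs N f v\<close> is
  discrete harmonicity at \<open>v\<close>.\<close>

definition mean_nbrs :: "nat \<Rightarrow> (site \<Rightarrow> real) \<Rightarrow> site \<Rightarrow> real" where
  "mean_nbrs N f v = (\<Sum>e\<in>dirs. f (move N v e)) / 4"

abbreviation dir_space :: "site stream measure" where
  "dir_space \<equiv> stream_space (uniform_count_measure dirs)"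

definition exit_measure :: "nat \<Rightarrow> site set \<Rightarrow> site \<Rightarrow> site measure" where
  "exit_measure N A v = distr dir_space (count_space UNIV) (\<lambda>s. exit_site A (srw N (v, s)))"

text \<open>As a pmf the exit law can be compared by point masses and composed by bind free of
  measurability conditions; \<open>measure_exit_pmf\<close> justifies \<open>Abs_pmf\<close>, the
  site type being countable.\<close>

definition exit_pmf :: "nat \<Rightarrow> site set \<Rightarrow> site \<Rightarrow> site pmf" where
  "exit_pmf N A v = Abs_pmf (exit_measure N A v)"

lemma card_dirs: "card dirs = 4"
  by (simp add: dirs_def)

lemma mean_nbrs_eq:
  "mean_nbrs N f (x, y) = (f ((x + 1) mod int N, y) + f ((x - 1) mod int N, y)
     + f (x mod int N, y + 1) + f (x mod int N, y - 1)) / 4"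
  by (simp add: mean_nbrs_def dirs_def move_def)

lemma mean_nbrs_diff: "mean_nbrs N (\<lambda>v. f v - g v) v = mean_nbrs N f v - mean_nbrs N g v"
  by (simp add: mean_nbrs_def sum_subtractf diff_divide_distrib)

lemma mean_nbrs_minus: "mean_nbrs N (\<lambda>v. - f v) v = - mean_nbrs N f v"
  by (simp add: mean_nbrs_def sum_negf)

lemma mean_nbrs_cmult: "mean_nbrs N (\<lambda>v. c * f v) v = c * mean_nbrs N f v"
  by (simp add: mean_nbrs_def sum_distrib_left)

lemma mean_nbrs_const: "mean_nbrs N (\<lambda>v. c) v = c"
  by (simp add: mean_nbrs_def card_dirs)

lemma prob_space_dir_space: "prob_space dir_space"
  using finite_dirs by (intro prob_space.prob_space_stream_space prob_space_uniform_count_measure)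

lemma measurable_srw_dir [measurable]: "(\<lambda>s. srw N (v, s) n) \<in> dir_space \<rightarrow>\<^sub>M count_space UNIV"
proof (induction n)
  case (Suc n)
  note [measurable] = Suc
  have [measurable]: "(\<lambda>s. s !! n) \<in> dir_space \<rightarrow>\<^sub>M count_space UNIV"
    by (rule measurable_compose[OF measurable_snth])
       (simp add: measurable_def space_uniform_count_measure)
  show ?case by simp
qed simp

lemma measurable_exit_site_dir [measurable]:
  "(\<lambda>s. exit_site A (srw N (v, s))) \<in> dir_space \<rightarrow>\<^sub>M count_space UNIV"
  unfolding exit_site_def by measurable

lemma srw_Stream: "srw N (v, e ## s) (Suc n) = srw N (move N v e, s) n"
  by (induction n) auto

lemma exit_site_mem_iff:
  assumes "X \<inter> A = {}"
  shows "exit_site A s \<in> X \<longleftrightarrow> (\<exists>n. s n \<notin> A) \<and> exit_site A s \<in> X"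
proof -
  have "exit_site A s \<in> A" if "\<nexists>n. s n \<notin> A"
    using that by (auto simp: exit_site_def)
  then show ?thesis using assms by blast
qed

text \<open>Prepending a step at a site of \<open>A\<close> delays the exit by one. The claim
  concerns membership in a set disjoint from \<open>A\<close> because on paths that never leave,
  \<open>LEAST\<close> picks an unspecified index and the two values may be different sites of
  \<open>A\<close>.\<close>

lemma exit_site_Stream:
  assumes "X \<inter> A = {}" "v \<in> A"
  shows "exit_site A (srw N (v, e ## s)) \<in> X \<longleftrightarrow> exit_site A (srw N (move N v e, s)) \<in> X"
proof -
  let ?f = "srw N (v, e ## s)" and ?g = "srw N (move N v e, s)"
  have 0: "?f 0 = v" and S: "?f (Suc n) = ?g n" for n
    using srw_Stream by auto
  have ex: "(\<exists>n. ?f n \<notin> A) \<longleftrightarrow> (\<exists>n. ?g n \<notin> A)"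
    using 0 S assms(2) by (metis not0_implies_Suc)
  show ?thesis
  proof (cases "\<exists>n. ?f n \<notin> A")
    case True
    then obtain n where n: "?f n \<notin> A" by blast
    have "(LEAST n. ?f n \<notin> A) = Suc (LEAST n. ?f (Suc n) \<notin> A)"
      by (rule Least_Suc[where P = "\<lambda>n. ?f n \<notin> A", OF n]) (use 0 assms(2) in simp)
    then have "exit_site A ?f = exit_site A ?g"
      unfolding exit_site_def S by (simp only: S)
    then show ?thesis by simp
  next
    case False
    then show ?thesis using ex exit_site_mem_iff[OF assms(1)] by metis
  qed
qed

lemma exit_site_start: "v \<notin> A \<Longrightarrow> exit_site A (srw N (v, s)) = v"
proof -
  assume v: "v \<notin> A"
  have "(LEAST n. srw N (v, s) n \<notin> A) = 0"
    by (rule Least_eq_0) (use v in simp)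
  then show ?thesis by (simp add: exit_site_def)
qed

lemma measure_exit_measure:
  "measure (exit_measure N A v) X = measure dir_space {s \<in> space dir_space. exit_site A (srw N (v, s)) \<in> X}"
  unfolding exit_measure_def
  by (subst measure_distr) (auto simp: vimage_def Int_def conj_commute)

lemma prob_space_exit_measure: "prob_space (exit_measure N A v)"
  unfolding exit_measure_def
  by (intro prob_space.prob_space_distr prob_space_dir_space) measurable

lemma measure_exit_pmf: "measure_pmf (exit_pmf N A v) = exit_measure N A v"
  unfolding exit_pmf_def
proof (rule Abs_pmf_inverse, intro CollectI conjI prob_space_exit_measure)
  interpret prob_space "exit_measure N A v" by (rule prob_space_exit_measure)
  show sets: "sets (exit_measure N A v) = UNIV" by (simp add: exit_measure_def)
  show "AE x in exit_measure N A v. Sigma_Algebra.measure (exit_measure N A v) {x} \<noteq> 0"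
    unfolding AE_support_countable[OF sets] by (intro exI[of _ UNIV]) auto
qed

text \<open>Markov property at time 1: condition on the first direction; the rest of the stream is
  again i.i.d.\<close>

lemma exit_measure_recurrence:
  assumes "X \<inter> A = {}" "v \<in> A"
  shows "measure (exit_measure N A v) X = mean_nbrs N (\<lambda>v. measure (exit_measure N A v) X) v"
proof -
  interpret D: prob_space "uniform_count_measure dirs"
    using finite_dirs by (rule prob_space_uniform_count_measure)
  have "ennreal (measure (exit_measure N A v) X)
      = (\<integral>\<^sup>+e. ennreal (measure dir_space {s \<in> space dir_space. exit_site A (srw N (v, e ## s)) \<in> X})
           \<partial>uniform_count_measure dirs)"
    unfolding measure_exit_measure
    by (rule D.prob_stream_space) measurable
  also have "\<dots> = (\<integral>\<^sup>+e. ennreal (measure (exit_measure N A (move N v e)) X) \<partial>uniform_count_measure dirs)"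
    unfolding exit_site_Stream[OF assms] measure_exit_measure ..
  also have "\<dots> = (\<Sum>e\<in>dirs. ennreal (1 / 4) * ennreal (measure (exit_measure N A (move N v e)) X))"
    unfolding uniform_count_measure_def
    by (subst nn_integral_point_measure_finite)
       (auto simp: finite_dirs card_dirs measure_nonneg ennreal_mult')
  also have "\<dots> = ennreal (mean_nbrs N (\<lambda>v. measure (exit_measure N A v) X) v)"
    by (simp add: mean_nbrs_def ennreal_mult'[symmetric] sum_ennreal measure_nonneg sum_divide_distrib)
  finally show ?thesis
    by (simp add: mean_nbrs_def sum_nonneg measure_nonneg)
qed

lemma exit_pmf_outside: "v \<notin> A \<Longrightarrow> exit_pmf N A v = return_pmf v"
proof (rule pmf_eqI)
  fix u assume v: "v \<notin> A"
  interpret prob_space dir_space by (rule prob_space_dir_space)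
  show "pmf (exit_pmf N A v) u = pmf (return_pmf v) u"
    by (simp add: pmf.rep_eq measure_exit_pmf measure_exit_measure exit_site_start[OF v] prob_space indicator_def)
qed

section \<open>Maximum principle and almost sure exit\<close>

lemma ln_concave_nat:
  fixes n :: real
  assumes "n \<ge> 1"
  shows "ln (n + 2) + ln n < 2 * ln (n + 1)"
proof -
  have "ln (n + 2) + ln n = ln ((n + 2) * n)" using assms by (simp add: ln_mult)
  also have "\<dots> < ln ((n + 1) * (n + 1))"
    using assms by (subst ln_less_cancel_iff) (auto simp: algebra_simps add_pos_pos)
  also have "\<dots> = 2 * ln (n + 1)" using assms by (simp add: ln_mult)
  finally show ?thesis .
qed

text \<open>The set \<open>A\<close> is infinite downwards; the strictly superharmonic barrier \<open>\<epsilon> ln(h + 2 - y)\<close>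
  tends to infinity there and confines the maximum to a finite region.\<close>
lemma maximum_principle:
  assumes N: "N \<ge> 3"
    and height: "\<And>x y. (x, y) \<in> A \<Longrightarrow> y \<le> h"
    and bdd: "\<And>v. g v \<le> M"
    and sub: "\<And>v. v \<in> A \<Longrightarrow> g v \<le> mean_nbrs N g v"
    and out: "\<And>v. v \<in> cyl N - A \<Longrightarrow> g v \<le> 0"
    and v: "v \<in> cyl N"
  shows "g v \<le> 0"
proof (rule ccontr)
  assume "\<not> g v \<le> 0"
  then have pos: "g v > 0" by simp
  define b :: "site \<Rightarrow> real" where "b w = ln (real_of_int (h + 2 - snd w))" for w
  have vA: "v \<in> A" using pos out[of v] v by (cases "v \<in> A") auto
  then have vh: "snd v \<le> h" using height by (metis prod.collapse)
  \<comment> \<open>Scaled so that the barrier uses up half of \<open>g v\<close>, leaving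
    \<open>G v = g v / 2 > 0\<close>.\<close>
  define \<epsilon> where "\<epsilon> = g v / (2 * b v)"
  have bv: "b v > 0" using vh by (simp add: b_def)
  then have eps: "\<epsilon> > 0" using pos by (simp add: \<epsilon>_def)
  define G where "G w = g w - \<epsilon> * b w" for w
  have Gv: "G v > 0" using bv pos by (simp add: G_def \<epsilon>_def)
  \<comment> \<open>Level \<open>h + 1\<close> is included because the maximiser turns out to lie in
    \<open>A\<close>, hence at level \<open>h\<close> or lower, and must be compared with all its
    neighbours.\<close>
  define S where "S = {w \<in> cyl N. snd w \<le> h + 1 \<and> G w \<ge> G v}"
  have "S \<subseteq> {0..<int N} \<times> {h + 2 - \<lceil>exp (M / \<epsilon>)\<rceil>..h + 1}"
  proof
    fix w assume w: "w \<in> S"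
    then have "G w > 0" using Gv by (simp add: S_def)
    then have "\<epsilon> * b w < M" using bdd[of w] by (simp add: G_def)
    then have "b w < M / \<epsilon>" using eps by (simp add: field_simps)
    then have "exp (b w) < exp (M / \<epsilon>)" by simp
    moreover have "exp (b w) = real_of_int (h + 2 - snd w)"
      using w by (simp add: S_def b_def)
    ultimately have "real_of_int (h + 2 - snd w) < exp (M / \<epsilon>)" by metis
    then have "h + 2 - snd w \<le> \<lceil>exp (M / \<epsilon>)\<rceil>" by linarith
    then show "w \<in> {0..<int N} \<times> {h + 2 - \<lceil>exp (M / \<epsilon>)\<rceil>..h + 1}"
      using w by (cases w) (auto simp: S_def cyl_def)
  qed
  then have fin: "finite S" by (rule finite_subset) simp
  have vS: "v \<in> S" using v vh by (simp add: S_def)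
  have "Max (G ` S) \<in> G ` S" using fin vS by (intro Max_in) auto
  then obtain w where wS: "w \<in> S" and "G w = Max (G ` S)" by auto
  then have wmax: "G u \<le> G w" if "u \<in> S" for u using fin that by simp
  obtain x y where wxy: "w = (x, y)" by force
  have wc: "w \<in> cyl N" "y \<le> h + 1" using wS by (auto simp: S_def wxy)
  have "G w > 0" using wS Gv by (simp add: S_def)
  moreover have "\<epsilon> * b w \<ge> 0" using eps wc by (simp add: b_def wxy)
  ultimately have "g w > 0" by (simp add: G_def)
  then have wA: "w \<in> A" using out[of w] wc by (cases "w \<in> A") auto
  then have yh: "y \<le> h" using height wxy by blast
  have le: "G u \<le> G w" if "u \<in> cyl N" "snd u \<le> h + 1" for u
  proof (cases "u \<in> S")
    case False
    then have "G u < G v" using that by (auto simp: S_def)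
    also have "G v \<le> G w" using wmax vS by blast
    finally show ?thesis by simp
  qed (use wmax in auto)
  have "mean_nbrs N G w \<le> G w"
  proof -
    have "G (move N w e) \<le> G w" if "e \<in> dirs" for e
      using that yh by (intro le cyl_move N) (auto simp: move_def dirs_def wxy)
    then have "(\<Sum>e\<in>dirs. G (move N w e)) \<le> 4 * G w"
      using sum_bounded_above[of dirs "\<lambda>e. G (move N w e)" "G w"] by (simp add: card_dirs)
    then show ?thesis by (simp add: mean_nbrs_def)
  qed
  moreover have "mean_nbrs N G w = mean_nbrs N g w - \<epsilon> * mean_nbrs N b w"
    unfolding G_def mean_nbrs_diff mean_nbrs_cmult ..
  moreover have "mean_nbrs N b w < b w"
    using ln_concave_nat[of "real_of_int (h + 1 - y)"] yh
    by (simp add: wxy mean_nbrs_eq b_def algebra_simps)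
  then have "\<epsilon> * mean_nbrs N b w < \<epsilon> * b w" using eps by simp
  ultimately show False using sub[OF wA] by (simp add: G_def)
qed

lemma Omega_subset_cyl: "A \<in> Omega N \<Longrightarrow> A \<subseteq> cyl N"
  by (auto simp: Omega_def Rle_def)

text \<open>The probability of never leaving, as a function of the start, is bounded, satisfies the
  averaging identity on \<open>A\<close> and vanishes outside, so the maximum principle makes it 0:
  the walk leaves \<open>A\<close> almost surely.\<close>

lemma set_exit_pmf:
  assumes N: "N \<ge> 3" and A: "A \<in> Omega N"
  shows "set_pmf (exit_pmf N A v) \<inter> A = {}"
proof (cases "v \<in> A")
  case False
  then show ?thesis by (simp add: exit_pmf_outside)
next
  case True
  note h = cluster_height_Omega(2)[OF N A]
  interpret prob_space "exit_measure N A u" for u by (rule prob_space_exit_measure)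
  define g where "g u = 1 - measure (exit_measure N A u) (- A)" for u
  have "g v \<le> 0"
  proof (rule maximum_principle[OF N h])
    show "g u \<le> 1" for u by (simp add: g_def)
    show "g u \<le> mean_nbrs N g u" if "u \<in> A" for u
      using exit_measure_recurrence[of "- A" A u N] that
      by (simp add: g_def[abs_def] mean_nbrs_diff mean_nbrs_const)
    show "g u \<le> 0" if "u \<in> cyl N - A" for u
      using that by (simp add: g_def measure_exit_pmf[symmetric] exit_pmf_outside)
    show "v \<in> cyl N" using Omega_subset_cyl[OF A] True by blast
  qed
  then have "measure (exit_measure N A v) (- A) = 1"
    by (simp add: g_def) (meson antisym_conv prob_le_1)
  then have "measure_pmf.prob (exit_pmf N A v) (- A) = 1" by (simp add: measure_exit_pmf)
  then have "AE x in measure_pmf (exit_pmf N A v). x \<in> - A"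
    by (subst (asm) measure_pmf.prob_eq_1) auto
  then show ?thesis by (auto simp: AE_measure_pmf_iff)
qed

text \<open>The recurrence settles the point masses outside \<open>A\<close>; at sites of
  \<open>A\<close> both sides vanish because the walk leaves almost surely.\<close>

lemma exit_pmf_step:
  assumes N: "N \<ge> 3" and A: "A \<in> Omega N" and v: "v \<in> A"
  shows "exit_pmf N A v = pmf_of_set dirs \<bind> (\<lambda>e. exit_pmf N A (move N v e))"
proof (rule pmf_eqI)
  fix u
  show "pmf (exit_pmf N A v) u = pmf (pmf_of_set dirs \<bind> (\<lambda>e. exit_pmf N A (move N v e))) u"
  proof (cases "u \<in> A")
    case True
    then have "pmf (exit_pmf N A w) u = 0" for w
      using set_exit_pmf[OF N A, of w] by (auto simp: set_pmf_iff)
    then show ?thesis by (simp add: pmf_bind)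
  next
    case False
    then have "{u} \<inter> A = {}" by simp
    from exit_measure_recurrence[OF this v, of N] show ?thesis
      using finite_dirs
      by (simp add: pmf_bind_pmf_of_set mean_nbrs_def card_dirs)
        (simp add: pmf.rep_eq measure_exit_pmf)
  qed
qed

section \<open>Optional stopping and the strong Markov property\<close>

lemma integrable_bounded_pmf:
  fixes f :: "'a \<Rightarrow> real"
  assumes "\<And>x. \<bar>f x\<bar> \<le> M"
  shows "integrable (measure_pmf p) f"
  using assms by (intro measure_pmf.integrable_const_bound[where B = M]) auto

lemma expectation_bounded_pmf:
  fixes f :: "'a \<Rightarrow> real"
  assumes "\<And>x. \<bar>f x\<bar> \<le> M"
  shows "\<bar>measure_pmf.expectation p f\<bar> \<le> M"
proof -
  have "integrable (measure_pmf p) f" by (rule integrable_bounded_pmf[OF assms])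
  moreover have "- M \<le> f x" "f x \<le> M" for x using assms[of x] by (simp_all add: abs_le_iff)
  ultimately have "- M \<le> measure_pmf.expectation p f" "measure_pmf.expectation p f \<le> M"
    by (auto intro!: measure_pmf.integral_ge_const measure_pmf.integral_le_const)
  then show ?thesis by simp
qed

lemma expectation_bind_pmf:
  fixes f :: "'b \<Rightarrow> real"
  assumes bdd: "\<And>x. \<bar>f x\<bar> \<le> M"
  shows "measure_pmf.expectation (p \<bind> q) f
       = measure_pmf.expectation p (\<lambda>x. measure_pmf.expectation (q x) f)"
proof -
  \<comment> \<open>Shifting by \<open>M\<close> makes the integrand nonnegative, so the claim
    reduces to the nonnegative integral of a bind.\<close>
  define g where "g x = f x + M" for x
  have g0: "0 \<le> g x" and g2: "\<bar>g x\<bar> \<le> 2 * M" for x using bdd[of x] by (auto simp: g_def)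
  define E where "E x = measure_pmf.expectation (q x) g" for x
  have E0: "0 \<le> E x" and E2: "\<bar>E x\<bar> \<le> 2 * M" for x
    using expectation_bounded_pmf[of g "2 * M" "q x", OF g2] g0 by (auto simp: E_def integral_nonneg)
  have "ennreal (measure_pmf.expectation (p \<bind> q) g) = (\<integral>\<^sup>+x. ennreal (g x) \<partial>measure_pmf (p \<bind> q))"
    by (rule nn_integral_eq_integral[symmetric, OF integrable_bounded_pmf[OF g2]]) (simp add: g0)
  also have "\<dots> = (\<integral>\<^sup>+x. \<integral>\<^sup>+y. ennreal (g y) \<partial>measure_pmf (q x) \<partial>measure_pmf p)" by simp
  also have "\<dots> = (\<integral>\<^sup>+x. ennreal (E x) \<partial>measure_pmf p)"
    unfolding E_def
    by (subst nn_integral_eq_integral[OF integrable_bounded_pmf[OF g2]]) (simp_all add: g0)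
  also have "\<dots> = ennreal (measure_pmf.expectation p E)"
    by (rule nn_integral_eq_integral[OF integrable_bounded_pmf[OF E2]]) (simp add: E0)
  finally have "measure_pmf.expectation (p \<bind> q) g = measure_pmf.expectation p E"
    using g0 E0 by (simp add: integral_nonneg)
  moreover have "measure_pmf.expectation r g = measure_pmf.expectation r f + M" for r
    unfolding g_def by (subst Bochner_Integration.integral_add) (auto intro: integrable_bounded_pmf[OF bdd])
  moreover have "\<bar>measure_pmf.expectation (q x) f\<bar> \<le> M" for x by (rule expectation_bounded_pmf[OF bdd])
  then have "measure_pmf.expectation p (\<lambda>x. measure_pmf.expectation (q x) f + M)
      = measure_pmf.expectation p (\<lambda>x. measure_pmf.expectation (q x) f) + M"
    by (subst Bochner_Integration.integral_add) (auto intro: integrable_bounded_pmf)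
  ultimately show ?thesis by (simp add: E_def[abs_def])
qed

lemma expectation_exit_pmf_step:
  fixes f :: "site \<Rightarrow> real"
  assumes "N \<ge> 3" "A \<in> Omega N" "v \<in> A" "\<And>x. \<bar>f x\<bar> \<le> M"
  shows "measure_pmf.expectation (exit_pmf N A v) f
       = mean_nbrs N (\<lambda>v. measure_pmf.expectation (exit_pmf N A v) f) v"
  unfolding exit_pmf_step[OF assms(1-3)]
  by (subst expectation_bind_pmf[OF assms(4)])
     (simp_all add: integral_pmf_of_set finite_dirs card_dirs mean_nbrs_def)

text \<open>The difference of \<open>f\<close> and its expected value at the exit site is bounded,
  subharmonic on \<open>A\<close> and zero outside; the maximum principle bounds it by 0.\<close>

lemma optional_stopping:
  fixes f :: "site \<Rightarrow> real"
  assumes N: "N \<ge> 3" and A: "A \<in> Omega N" and v: "v \<in> cyl N"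
    and bdd: "\<And>x. \<bar>f x\<bar> \<le> M"
    and sub: "\<And>v. v \<in> A \<Longrightarrow> f v \<le> mean_nbrs N f v"
  shows "f v \<le> measure_pmf.expectation (exit_pmf N A v) f"
proof -
  note h = cluster_height_Omega(2)[OF N A]
  define E where "E v = measure_pmf.expectation (exit_pmf N A v) f" for v
  have "(\<lambda>v. f v - E v) v \<le> 0"
  proof (rule maximum_principle[OF N h _ _ _ v])
    show "f u - E u \<le> 2 * M" for u
      using bdd[of u] expectation_bounded_pmf[of f M "exit_pmf N A u", OF bdd] by (simp add: E_def)
    show "f u - E u \<le> mean_nbrs N (\<lambda>v. f v - E v) u" if u: "u \<in> A" for u
      using expectation_exit_pmf_step[OF N A u bdd] sub[OF u]
      by (simp add: mean_nbrs_diff E_def[abs_def])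
    show "f u - E u \<le> 0" if "u \<in> cyl N - A" for u
      using that by (simp add: E_def exit_pmf_outside)
  qed
  then show ?thesis by (simp add: E_def)
qed

lemma optional_stopping_eq:
  fixes f :: "site \<Rightarrow> real"
  assumes N: "N \<ge> 3" and A: "A \<in> Omega N" and v: "v \<in> cyl N"
    and bdd: "\<And>x. \<bar>f x\<bar> \<le> M"
    and harm: "\<And>v. v \<in> A \<Longrightarrow> f v = mean_nbrs N f v"
  shows "measure_pmf.expectation (exit_pmf N A v) f = f v"
proof (rule antisym)
  show "f v \<le> measure_pmf.expectation (exit_pmf N A v) f"
    using harm by (intro optional_stopping[OF N A v bdd]) auto
  have "- f v \<le> measure_pmf.expectation (exit_pmf N A v) (\<lambda>x. - f x)"
    using harm bdd by (intro optional_stopping[OF N A v, where M = M]) (auto simp: mean_nbrs_minus)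
  then show "measure_pmf.expectation (exit_pmf N A v) f \<le> f v" by simp
qed

text \<open>The probability of leaving \<open>B\<close> at \<open>u\<close> is harmonic on
  \<open>B\<close> in the starting site, hence on \<open>A\<close>; stopping it at the exit from
  \<open>A\<close> gives the identity.\<close>

lemma exit_pmf_strong_markov:
  assumes N: "N \<ge> 3" and A: "A \<in> Omega N" and B: "B \<in> Omega N" and sub: "A \<subseteq> B"
  shows "exit_pmf N B v = exit_pmf N A v \<bind> exit_pmf N B"
proof (cases "v \<in> cyl N")
  case False
  then have "v \<notin> A" using Omega_subset_cyl[OF A] by blast
  then show ?thesis by (simp add: exit_pmf_outside bind_return_pmf)
next
  case v: True
  show ?thesis
  proof (rule pmf_eqI)
    fix u
    have "measure_pmf.expectation (exit_pmf N A v) (\<lambda>w. pmf (exit_pmf N B w) u) = pmf (exit_pmf N B v) u"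
    proof (rule optional_stopping_eq[OF N A v])
      show "\<bar>pmf (exit_pmf N B w) u\<bar> \<le> 1" for w by (simp add: pmf_le_1)
      show "pmf (exit_pmf N B w) u = mean_nbrs N (\<lambda>w. pmf (exit_pmf N B w) u) w" if "w \<in> A" for w
      proof -
        have "w \<in> B" using that sub by blast
        show ?thesis
          by (subst exit_pmf_step[OF N B \<open>w \<in> B\<close>])
             (use finite_dirs in \<open>simp add: pmf_bind_pmf_of_set card_dirs mean_nbrs_def\<close>)
      qed
    qed
    then show "pmf (exit_pmf N B v) u = pmf (exit_pmf N A v \<bind> exit_pmf N B) u"
      by (simp add: pmf_bind)
  qed
qed

lemma set_exit_pmf_cyl:
  assumes N: "N \<ge> 3" and v: "v \<in> cyl N"
  shows "set_pmf (exit_pmf N A v) \<subseteq> cyl N"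
proof -
  interpret prob_space dir_space by (rule prob_space_dir_space)
  have "exit_site A (srw N (v, s)) \<in> cyl N" for s
    unfolding exit_site_def by (rule srw_in_cyl[OF N]) (use v in simp)
  then have "measure_pmf.prob (exit_pmf N A v) (cyl N) = 1"
    by (simp add: measure_exit_pmf measure_exit_measure prob_space)
  then have "AE x in measure_pmf (exit_pmf N A v). x \<in> cyl N"
    by (subst (asm) measure_pmf.prob_eq_1) auto
  then show ?thesis by (auto simp: AE_measure_pmf_iff)
qed

section \<open>The abelian property\<close>

text \<open>The start \<open>v\<close> may lie outside \<open>A\<close>; the particle then settles
  where it is, which lets a cluster be rebuilt by releasing particles on its own sites.\<close>

definition add_particle :: "nat \<Rightarrow> site set \<Rightarrow> site \<Rightarrow> site set pmf" where
  "add_particle N A v = map_pmf (\<lambda>z. insert z A) (exit_pmf N A v)"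

definition idla_step :: "nat \<Rightarrow> site set \<Rightarrow> site set pmf" where
  "idla_step N A = pmf_of_set (level N 0) \<bind> add_particle N A"

primrec idla_pmf :: "nat \<Rightarrow> nat \<Rightarrow> site set \<Rightarrow> site set pmf" where
  "idla_pmf N 0 A = return_pmf A"
| "idla_pmf N (Suc t) A = idla_step N A \<bind> idla_pmf N t"

primrec add_particles :: "nat \<Rightarrow> site list \<Rightarrow> site set \<Rightarrow> site set pmf" where
  "add_particles N [] A = return_pmf A"
| "add_particles N (v # vs) A = add_particle N A v \<bind> add_particles N vs"

lemma level_subset_cyl: "level N k \<subseteq> cyl N"
  by (auto simp: level_def cyl_def)

lemma card_level: "card (level N k) = N"
  by (simp add: level_def)

lemma insert_exit_pmf_Omega:
  assumes "N \<ge> 3" "A \<in> Omega N" "v \<in> cyl N" "z \<in> set_pmf (exit_pmf N A v)"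
  shows "insert z A \<in> Omega N"
  using assms set_exit_pmf_cyl insert_Omega by blast

lemma set_add_particle:
  assumes "N \<ge> 3" "A \<in> Omega N" "v \<in> cyl N" "B \<in> set_pmf (add_particle N A v)"
  shows "B \<in> Omega N" "A \<subseteq> B"
  using assms by (auto simp: add_particle_def intro: insert_exit_pmf_Omega)

lemma set_idla_step:
  assumes "N \<ge> 3" "A \<in> Omega N" "B \<in> set_pmf (idla_step N A)"
  shows "\<exists>v\<in>level N 0. B \<in> set_pmf (add_particle N A v)"
  using assms level_0[OF assms(1)] by (auto simp: idla_step_def set_pmf_of_set)

text \<open>Let both particles run independently until they leave \<open>A\<close>, at
  \<open>x\<close> and \<open>y\<close>. If \<open>x\<close> and \<open>y\<close> differ, both sites
  are filled; if they agree, one particle stays and the other walks on. By the strong Markov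
  property this is the law of adding them in succession, and it is symmetric in \<open>x\<close> and
  \<open>y\<close>.\<close>

lemma add_particle_commute:
  assumes N: "N \<ge> 3" and A: "A \<in> Omega N" and u: "u \<in> cyl N" and v: "v \<in> cyl N"
  shows "add_particle N A u \<bind> (\<lambda>B. add_particle N B v)
       = add_particle N A v \<bind> (\<lambda>B. add_particle N B u)"
proof -
  \<comment> \<open>Law of the final cluster given the exit sites \<open>x\<close> and
    \<open>y\<close> from \<open>A\<close>.\<close>
  define J where "J x y = (if y = x then map_pmf (\<lambda>z. insert z (insert x A)) (exit_pmf N (insert x A) x)
      else return_pmf (insert x (insert y A)))" for x y
  have J: "add_particle N A u \<bind> (\<lambda>B. add_particle N B v)
      = exit_pmf N A u \<bind> (\<lambda>x. exit_pmf N A v \<bind> J x)"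
    if u: "u \<in> cyl N" for u v
  proof -
    have "add_particle N (insert x A) v = exit_pmf N A v \<bind> J x"
      if x: "x \<in> set_pmf (exit_pmf N A u)" for x
    proof -
      have "exit_pmf N (insert x A) v = exit_pmf N A v \<bind> exit_pmf N (insert x A)"
        by (rule exit_pmf_strong_markov[OF N A insert_exit_pmf_Omega[OF N A u x]]) auto
      then have "add_particle N (insert x A) v
          = exit_pmf N A v \<bind> (\<lambda>y. map_pmf (\<lambda>z. insert z (insert x A)) (exit_pmf N (insert x A) y))"
        by (simp add: add_particle_def map_bind_pmf)
      also have "\<dots> = exit_pmf N A v \<bind> J x"
      proof (rule bind_pmf_cong[OF refl])
        fix y assume "y \<in> set_pmf (exit_pmf N A v)"
        then have "y \<notin> A" using set_exit_pmf[OF N A] by blast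
        then show "map_pmf (\<lambda>z. insert z (insert x A)) (exit_pmf N (insert x A) y) = J x y"
          by (simp add: J_def exit_pmf_outside insert_commute)
      qed
      finally show ?thesis .
    qed
    then show ?thesis
      unfolding add_particle_def[of N A u] bind_map_pmf
      by (intro bind_pmf_cong) auto
  qed
  have "J x y = J y x" for x y by (auto simp: J_def insert_commute)
  then have "exit_pmf N A u \<bind> (\<lambda>x. exit_pmf N A v \<bind> J x)
      = exit_pmf N A v \<bind> (\<lambda>y. exit_pmf N A u \<bind> J y)"
    by (subst bind_commute_pmf) presburger
  then show ?thesis using J[OF u] J[OF v] by simp
qed

lemma idla_step_add_particle:
  assumes N: "N \<ge> 3" and A: "A \<in> Omega N" and v: "v \<in> cyl N"
  shows "add_particle N A v \<bind> idla_step N = idla_step N A \<bind> (\<lambda>B. add_particle N B v)"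
proof -
  have "add_particle N A v \<bind> idla_step N
      = pmf_of_set (level N 0) \<bind> (\<lambda>u. add_particle N A v \<bind> (\<lambda>B. add_particle N B u))"
    unfolding idla_step_def by (rule bind_commute_pmf)
  also have "\<dots> = pmf_of_set (level N 0) \<bind> (\<lambda>u. add_particle N A u \<bind> (\<lambda>B. add_particle N B v))"
    using level_0[OF N] level_subset_cyl
    by (intro bind_pmf_cong refl add_particle_commute[OF N A v]) (auto simp: set_pmf_of_set)
  also have "\<dots> = idla_step N A \<bind> (\<lambda>B. add_particle N B v)"
    by (simp add: idla_step_def bind_assoc_pmf)
  finally show ?thesis .
qed

lemma set_idla_step_Omega:
  assumes "N \<ge> 3" "A \<in> Omega N" "B \<in> set_pmf (idla_step N A)"
  shows "B \<in> Omega N"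
  using set_idla_step[OF assms] set_add_particle(1)[OF assms(1,2)] level_subset_cyl by blast

lemma set_idla_pmf_Omega:
  assumes "N \<ge> 3" "A \<in> Omega N" "B \<in> set_pmf (idla_pmf N t A)"
  shows "B \<in> Omega N"
  using assms(2,3)
proof (induction t arbitrary: A)
  case (Suc t)
  then show ?case using set_idla_step_Omega[OF assms(1)] by auto
qed simp

lemma idla_pmf_add_particle:
  assumes N: "N \<ge> 3" and A: "A \<in> Omega N" and v: "v \<in> cyl N"
  shows "add_particle N A v \<bind> idla_pmf N t = idla_pmf N t A \<bind> (\<lambda>B. add_particle N B v)"
  using A
proof (induction t arbitrary: A)
  case 0
  then show ?case by (simp add: bind_return_pmf bind_return_pmf')
next
  case (Suc t)
  have "add_particle N A v \<bind> (\<lambda>B. idla_step N B \<bind> idla_pmf N t)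
      = (add_particle N A v \<bind> idla_step N) \<bind> idla_pmf N t"
    by (simp add: bind_assoc_pmf)
  also have "\<dots> = idla_step N A \<bind> (\<lambda>B. add_particle N B v \<bind> idla_pmf N t)"
    by (simp add: idla_step_add_particle[OF N Suc.prems v] bind_assoc_pmf)
  also have "\<dots> = idla_step N A \<bind> (\<lambda>B. idla_pmf N t B \<bind> (\<lambda>B. add_particle N B v))"
    using set_idla_step_Omega[OF N Suc.prems] by (intro bind_pmf_cong refl Suc.IH)
  finally show ?case by (simp only: idla_pmf.simps bind_assoc_pmf)
qed

lemma idla_pmf_add_particles:
  assumes N: "N \<ge> 3" and A: "A \<in> Omega N" and vs: "set vs \<subseteq> cyl N"
  shows "add_particles N vs A \<bind> idla_pmf N t = idla_pmf N t A \<bind> add_particles N vs"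
  using A vs
proof (induction vs arbitrary: A)
  case Nil
  then show ?case by (simp add: bind_return_pmf bind_return_pmf')
next
  case (Cons v vs)
  then have v: "v \<in> cyl N" and vs: "set vs \<subseteq> cyl N" by auto
  have "add_particles N (v # vs) A \<bind> idla_pmf N t
      = add_particle N A v \<bind> (\<lambda>B. add_particles N vs B \<bind> idla_pmf N t)"
    by (simp add: bind_assoc_pmf)
  also have "\<dots> = add_particle N A v \<bind> (\<lambda>B. idla_pmf N t B \<bind> add_particles N vs)"
    using set_add_particle(1)[OF N Cons.prems(1) v] vs by (intro bind_pmf_cong refl Cons.IH)
  also have "\<dots> = (idla_pmf N t A \<bind> (\<lambda>B. add_particle N B v)) \<bind> add_particles N vs"
    by (simp add: idla_pmf_add_particle[OF N Cons.prems(1) v, symmetric] bind_assoc_pmf)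
  finally show ?case by (simp add: bind_assoc_pmf)
qed

text \<open>Each particle starts on a site still empty at its turn, so nothing is random.\<close>

lemma add_particles_outside:
  "distinct vs \<Longrightarrow> set vs \<inter> A = {} \<Longrightarrow> add_particles N vs A = return_pmf (A \<union> set vs)"
  by (induction vs arbitrary: A) (auto simp: add_particle_def exit_pmf_outside bind_return_pmf)

section \<open>Agreement of the process with its pmf version\<close>

lemma idla_Stream:
  "idla N A (w ## W) (Suc t) = idla N (insert (exit_site A (srw N w)) A) W t"
  by (induction t) auto

text \<open>Fubini: the start and the direction stream are independent, so integrating out the
  directions leaves the exit law.\<close>

lemma nn_integral_exit_site_walk_space:
  assumes N: "N \<ge> 3"
  shows "(\<integral>\<^sup>+w. F (exit_site A (srw N w)) \<partial>walk_space N)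
       = (\<integral>\<^sup>+v. \<integral>\<^sup>+z. F z \<partial>exit_pmf N A v \<partial>pmf_of_set (level N 0))"
proof -
  interpret D: prob_space dir_space by (rule prob_space_dir_space)
  have [measurable]: "(\<lambda>w. F (exit_site A (srw N w))) \<in> borel_measurable (walk_space N)"
    by (rule measurable_compose[OF measurable_exit_site]) simp
  have [measurable]: "(\<lambda>w. F (exit_site A (srw N w)))
      \<in> borel_measurable (uniform_count_measure (level N 0) \<Otimes>\<^sub>M dir_space)"
    by (metis \<open>(\<lambda>w. F (exit_site A (srw N w))) \<in> borel_measurable (walk_space N)\<close> walk_space_def)
  have "(\<integral>\<^sup>+w. F (exit_site A (srw N w)) \<partial>walk_space N)
      = (\<integral>\<^sup>+v. \<integral>\<^sup>+s. F (exit_site A (srw N (v, s))) \<partial>dir_space \<partial>uniform_count_measure (level N 0))"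
    unfolding walk_space_def
    by (rule D.nn_integral_fst[symmetric]) measurable
  also have "\<dots> = (\<integral>\<^sup>+v. \<integral>\<^sup>+z. F z \<partial>exit_pmf N A v \<partial>uniform_count_measure (level N 0))"
    unfolding measure_exit_pmf exit_measure_def
    by (subst nn_integral_distr) auto
  also have "\<dots> = (\<integral>\<^sup>+v. \<integral>\<^sup>+z. F z \<partial>exit_pmf N A v \<partial>pmf_of_set (level N 0))"
    using N level_0[OF N] unfolding uniform_count_measure_def
    by (subst nn_integral_point_measure_finite)
       (simp_all add: nn_integral_pmf_of_set card_level sum_distrib_left[symmetric]
          divide_ennreal_def divide_ennreal[symmetric] inverse_eq_divide mult.commute
          flip: ennreal_of_nat_eq_real_of_nat)
  finally show ?thesis .
qed

text \<open>Induction with the initial cluster generalised: conditioning on the first walk leaves an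
  i.i.d. stream driving the process from the enlarged cluster.\<close>

lemma emeasure_idla:
  assumes N: "N \<ge> 3" and A: "A \<in> Omega N" and S: "S \<subseteq> Omega N"
  shows "ennreal (measure (stream_space (walk_space N))
            {W \<in> space (stream_space (walk_space N)). idla N A W t \<in> S})
       = emeasure (measure_pmf (idla_pmf N t A)) S"
  using A
proof (induction t arbitrary: A)
  case 0
  interpret prob_space "stream_space (walk_space N)"
    using prob_space_walk_space[OF N] by (rule prob_space.prob_space_stream_space)
  show ?case by (cases "A \<in> S") (simp_all add: prob_space)
next
  case (Suc t)
  let ?M = "stream_space (walk_space N)"
  interpret W: prob_space "walk_space N" by (rule prob_space_walk_space[OF N])
  have meas: "{W \<in> space ?M. idla N A W t \<in> S} \<in> sets ?M" if "A \<in> Omega N" for A t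
    using measurable_sets[OF measurable_idla[OF N that, of t], of S] S
    by (simp add: vimage_def Int_def conj_commute)
  have "ennreal (measure ?M {W \<in> space ?M. idla N A W (Suc t) \<in> S})
      = (\<integral>\<^sup>+w. ennreal (measure ?M {W \<in> space ?M. idla N A (w ## W) (Suc t) \<in> S}) \<partial>walk_space N)"
    by (rule W.prob_stream_space[OF meas[OF Suc.prems]])
  also have "\<dots> = (\<integral>\<^sup>+w. emeasure (measure_pmf (idla_pmf N t (insert (exit_site A (srw N w)) A))) S
      \<partial>walk_space N)"
    unfolding idla_Stream
    using exit_site_in_cyl[OF N] Suc.prems
    by (intro nn_integral_cong Suc.IH insert_Omega)
  also have "\<dots> = emeasure (measure_pmf (idla_pmf N (Suc t) A)) S"
    by (subst nn_integral_exit_site_walk_space[OF N, where F = "\<lambda>z. emeasure (measure_pmf (idla_pmf N t (insert z A))) S"])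
       (simp add: idla_step_def add_particle_def emeasure_bind_pmf)
  finally show ?case .
qed

lemma measure_idla_law:
  assumes N: "N \<ge> 3" and A: "A \<in> Omega N" and S: "S \<subseteq> Omega N"
  shows "measure (idla_law N A t) S = measure_pmf.prob (idla_pmf N (nat \<lfloor>t\<rfloor>) A) S"
proof -
  have "measure (idla_law N A t) S = measure (stream_space (walk_space N))
      {W \<in> space (stream_space (walk_space N)). idla N A W (nat \<lfloor>t\<rfloor>) \<in> S}"
    unfolding idla_law_def
    using S by (subst measure_distr[OF measurable_idla[OF N A]])
      (auto simp: vimage_def Int_def conj_commute)
  then show ?thesis
    using emeasure_idla[OF assms, of "nat \<lfloor>t\<rfloor>"]
    by (simp add: measure_pmf.emeasure_eq_measure measure_nonneg)
qed

section \<open>Mixing of harmonic functions\<close>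

definition level_sum :: "nat \<Rightarrow> (site \<Rightarrow> real) \<Rightarrow> int \<Rightarrow> real" where
  "level_sum N f y = (\<Sum>x\<in>{0..<int N}. f (x, y))"

lemma sum_rotate:
  assumes "N \<ge> 3"
  shows "(\<Sum>x\<in>{0..<int N}. f ((x + c) mod int N)) = (\<Sum>x\<in>{0..<int N}. f x)"
proof (rule sum.reindex_bij_witness[of _ "\<lambda>x. (x - c) mod int N" "\<lambda>x. (x + c) mod int N"])
  fix x assume x: "x \<in> {0..<int N}"
  show "((x + c) mod int N - c) mod int N = x" "((x - c) mod int N + c) mod int N = x"
    using x by (simp_all add: mod_diff_left_eq mod_add_left_eq)
qed (use assms in auto)

lemma level_sum_mean_nbrs:
  assumes N: "N \<ge> 3"
  shows "level_sum N (mean_nbrs N f) y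
       = (2 * level_sum N f y + level_sum N f (y + 1) + level_sum N f (y - 1)) / 4"
proof -
  have "level_sum N (mean_nbrs N f) y
      = (\<Sum>x\<in>{0..<int N}. (f ((x + 1) mod int N, y) + f ((x + - 1) mod int N, y)
          + f (x, y + 1) + f (x, y - 1)) / 4)"
    unfolding level_sum_def by (intro sum.cong) (auto simp: mean_nbrs_eq)
  then show ?thesis
    unfolding sum_divide_distrib[symmetric] sum.distrib
      sum_rotate[OF N, of "\<lambda>x. f (x, y)"]
    by (simp add: level_sum_def)
qed

lemma abs_level_sum_le:
  assumes "\<And>v. \<bar>f v\<bar> \<le> M"
  shows "\<bar>level_sum N f y\<bar> \<le> real N * M"
proof -
  have "\<bar>level_sum N f y\<bar> \<le> (\<Sum>x\<in>{0..<int N}. \<bar>f (x, y)\<bar>)"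
    unfolding level_sum_def by (rule sum_abs)
  also have "\<dots> \<le> (\<Sum>x\<in>{0..<int N}. M)" by (intro sum_mono assms)
  finally show ?thesis by simp
qed

text \<open>Summing the averaging identity around a level shows that level sums are affine in the
  level. Boundedness on the downward infinite half cylinder forces slope 0.\<close>

lemma level_sum_const:
  assumes N: "N \<ge> 3" and bdd: "\<And>v. \<bar>f v\<bar> \<le> M"
    and harm: "\<And>v. v \<in> Rle N J \<Longrightarrow> f v = mean_nbrs N f v" and y: "y \<le> J + 1"
  shows "level_sum N f y = level_sum N f (J + 1)"
proof -
  define s where "s j = level_sum N f (J + 1 - int j)" for j
  define d where "d = s 1 - s 0"
  have rec: "s (Suc (Suc j)) + s j = 2 * s (Suc j)" for j
  proof -
    have "level_sum N f (J - int j) = level_sum N (mean_nbrs N f) (J - int j)"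
      unfolding level_sum_def by (intro sum.cong refl harm) (auto simp: Rle_def cyl_def)
    then have "4 * level_sum N f (J - int j)
        = 2 * level_sum N f (J - int j) + level_sum N f (J - int j + 1) + level_sum N f (J - int j - 1)"
      by (simp add: level_sum_mean_nbrs[OF N])
    then show ?thesis by (simp add: s_def algebra_simps)
  qed
  have lin: "s (Suc j) - s j = d" for j
  proof (induction j)
    case (Suc j)
    then show ?case using rec[of j] by simp
  qed (simp add: d_def)
  have lin': "s j = s 0 + real j * d" for j
  proof (induction j)
    case (Suc j)
    then show ?case using lin[of j] by (simp add: algebra_simps)
  qed simp
  have "d = 0"
  proof (rule ccontr)
    assume "d \<noteq> 0"
    then obtain n :: nat where n: "2 * (real N * M) < real n * \<bar>d\<bar>"
      using ex_less_of_nat_mult[of "\<bar>d\<bar>" "2 * (real N * M)"] by auto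
    have "real n * \<bar>d\<bar> = \<bar>s n - s 0\<bar>" using lin'[of n] by (simp add: abs_mult)
    also have "\<dots> \<le> 2 * (real N * M)"
      using abs_level_sum_le[of f M N "J + 1 - int n", OF bdd] abs_level_sum_le[of f M N "J + 1", OF bdd]
      by (simp add: s_def)
    finally show False using n by simp
  qed
  then have "s (nat (J + 1 - y)) = s 0" using lin' by simp
  then show ?thesis using y by (simp add: s_def)
qed

section \<open>Poincare inequality and geometric decay\<close>

lemma cycle_total_variation:
  fixes f :: "int \<Rightarrow> real"
  assumes "x \<in> {0..<int N}" "y \<in> {0..<int N}"
  shows "\<bar>f x - f y\<bar> \<le> (\<Sum>z\<in>{0..<int N}. \<bar>f ((z + 1) mod int N) - f z\<bar>)" (is "_ \<le> ?V")
proof -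
  have le: "\<bar>f b - f a\<bar> \<le> ?V" if ab: "0 \<le> a" "a \<le> b" "b < int N" for a b
  proof -
    have "\<bar>f b - f a\<bar> \<le> (\<Sum>z\<in>{a..<b}. \<bar>f (z + 1) - f z\<bar>)"
      using ab(2)
    proof (induction b rule: int_ge_induct)
      case (step i)
      have "{a..<i + 1} = insert i {a..<i}" using step by auto
      then show ?case using step by simp
    qed simp
    also have "\<dots> = (\<Sum>z\<in>{a..<b}. \<bar>f ((z + 1) mod int N) - f z\<bar>)"
      using ab by (intro sum.cong) auto
    also have "\<dots> \<le> ?V" using ab by (intro sum_mono2) auto
    finally show ?thesis .
  qed
  show ?thesis
    using le[of x y] le[of y x] assms by (cases "x \<le> y") (auto simp: abs_minus_commute)
qed

text \<open>A mean-zero function is at each point an average of differences, hence bounded by its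
  total variation; Cauchy-Schwarz compares that with the Dirichlet form. The constant is crude but
  of the right order.\<close>

lemma cycle_poincare:
  fixes f :: "int \<Rightarrow> real"
  assumes zero: "(\<Sum>x\<in>{0..<int N}. f x) = 0"
  shows "(\<Sum>x\<in>{0..<int N}. (f x)\<^sup>2)
       \<le> (real N)\<^sup>2 * (\<Sum>x\<in>{0..<int N}. (f ((x + 1) mod int N) - f x)\<^sup>2)"
proof -
  define V where "V = (\<Sum>z\<in>{0..<int N}. \<bar>f ((z + 1) mod int N) - f z\<bar>)"
  have le: "(f x)\<^sup>2 \<le> V\<^sup>2" if x: "x \<in> {0..<int N}" for x
  proof -
    have N: "real N > 0" using x by auto
    have "real N * \<bar>f x\<bar> = \<bar>\<Sum>y\<in>{0..<int N}. (f x - f y)\<bar>"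
      using N by (simp add: sum_subtractf zero abs_mult)
    also have "\<dots> \<le> (\<Sum>y\<in>{0..<int N}. \<bar>f x - f y\<bar>)" by (rule sum_abs)
    also have "\<dots> \<le> (\<Sum>y\<in>{0..<int N}. V)"
      unfolding V_def using x by (intro sum_mono cycle_total_variation) auto
    also have "\<dots> = real N * V" by simp
    finally have "\<bar>f x\<bar> \<le> V" using N by simp
    then show ?thesis by (simp add: abs_le_square_iff[symmetric])
  qed
  have "V\<^sup>2 \<le> real N * (\<Sum>x\<in>{0..<int N}. (f ((x + 1) mod int N) - f x)\<^sup>2)"
    using Cauchy_Schwarz_ineq_sum[of "\<lambda>_. 1" "\<lambda>z. \<bar>f ((z + 1) mod int N) - f z\<bar>" "{0..<int N}"]
    by (simp add: V_def)
  moreover have "(\<Sum>x\<in>{0..<int N}. (f x)\<^sup>2) \<le> (\<Sum>x\<in>{0..<int N}. V\<^sup>2)"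
    by (intro sum_mono le)
  then have "(\<Sum>x\<in>{0..<int N}. (f x)\<^sup>2) \<le> real N * V\<^sup>2" by simp
  ultimately show ?thesis
    by (smt (verit) mult.assoc mult_left_mono of_nat_0_le_iff power2_eq_square)
qed

text \<open>The recurrence with equality has characteristic roots \<open>q\<close> and
  \<open>1 / q\<close>. If \<open>b (Suc j) - q * b j\<close> were ever positive, it would grow by a
  factor of at least \<open>1 / q\<close> per step, against boundedness.\<close>

lemma geometric_decay_of_bounded:
  fixes b :: "nat \<Rightarrow> real"
  assumes nonneg: "\<And>j. 0 \<le> b j" and bdd: "\<And>j. b j \<le> M"
    and q: "0 < q" "q < 1"
    and rec: "\<And>j. (q + 1 / q) * b (Suc j) \<le> b (Suc (Suc j)) + b j"
  shows "b j \<le> q ^ j * b 0"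
proof -
  have step: "b (Suc j) \<le> q * b j" for j
  proof (rule ccontr)
    assume "\<not> b (Suc j) \<le> q * b j"
    define \<delta> where "\<delta> = b (Suc j) - q * b j"
    have \<delta>: "\<delta> > 0" using \<open>\<not> b (Suc j) \<le> q * b j\<close> by (simp add: \<delta>_def)
    have grow: "(1 / q) ^ n * \<delta> \<le> b (Suc (j + n)) - q * b (j + n)" for n
    proof (induction n)
      case (Suc n)
      have "(1 / q) ^ Suc n * \<delta> = (1 / q) * ((1 / q) ^ n * \<delta>)" by simp
      also have "\<dots> \<le> (1 / q) * (b (Suc (j + n)) - q * b (j + n))"
        using Suc.IH q by (intro mult_left_mono) auto
      also have "\<dots> = (q + 1 / q) * b (Suc (j + n)) - b (j + n) - q * b (Suc (j + n))"
        using q by (simp add: field_simps)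
      also have "\<dots> \<le> b (Suc (Suc (j + n))) - q * b (Suc (j + n))" using rec[of "j + n"] by simp
      finally show ?case by simp
    qed (simp add: \<delta>_def)
    obtain n where n: "M / \<delta> < (1 / q) ^ n"
      using real_arch_pow[of "1 / q" "M / \<delta>"] q by auto
    then have "M < (1 / q) ^ n * \<delta>" using \<delta> by (simp add: field_simps)
    also have "\<dots> \<le> b (Suc (j + n)) - q * b (j + n)" by (rule grow)
    also have "\<dots> \<le> M" using bdd[of "Suc (j + n)"] nonneg[of "j + n"] q by (smt (verit) mult_nonneg_nonneg)
    finally show False by simp
  qed
  show ?thesis
  proof (induction j)
    case (Suc j)
    have "b (Suc j) \<le> q * b j" by (rule step)
    also have "\<dots> \<le> q * (q ^ j * b 0)" using Suc q by (intro mult_left_mono) auto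
    finally show ?case by (simp add: mult.assoc)
  qed simp
qed

text \<open>On mean-zero functions the cycle Laplacian is at least \<open>1 / N\<^sup>2\<close>, so the \<open>\<ell>\<^sup>2\<close> norm of the
  mean-zero part of a bounded harmonic function decays geometrically downwards.\<close>
lemma harmonic_mixing:
  assumes N: "N \<ge> 3" and bdd: "\<And>v. \<bar>f v\<bar> \<le> M"
    and harm: "\<And>v. v \<in> Rle N J \<Longrightarrow> f v = mean_nbrs N f v"
    and v: "(x, y) \<in> cyl N" "y \<le> J + 1"
  shows "\<bar>f (x, y) - level_sum N f (J + 1) / real N\<bar>
       \<le> 2 * M * sqrt (real N) * (1 - 1 / (2 * real N)) ^ nat (J + 1 - y)"
proof -
  let ?I = "{0..<int N}"
  define c where "c = level_sum N f (J + 1) / real N"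
  \<comment> \<open>Mean-zero part of \<open>f\<close> at depth \<open>j\<close> below level
    \<open>J + 1\<close>; \<open>b j\<close> is its norm.\<close>
  define w where "w j x = f (x, J + 1 - int j) - c" for j x
  define b where "b j = L2_set (w j) ?I" for j
  have zero: "(\<Sum>x\<in>?I. w j x) = 0" for j
    using level_sum_const[where f = f and J = J, OF N bdd harm, of "J + 1 - int j"] N
    by (simp add: w_def sum_subtractf level_sum_def c_def)
  have "\<bar>c\<bar> \<le> M"
    using abs_level_sum_le[of f M N "J + 1", OF bdd] N by (simp add: c_def field_simps)
  then have w_le: "\<bar>w j x\<bar> \<le> 2 * M" for j x
    unfolding w_def using bdd[of "(x, J + 1 - int j)"] by linarith
  have b2: "(b j)\<^sup>2 = (\<Sum>x\<in>?I. (w j x)\<^sup>2)" for j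
    by (simp add: b_def L2_set_def sum_nonneg)
  have M: "0 \<le> M" using bdd[of undefined] by linarith
  have b_le: "b j \<le> 2 * M * sqrt (real N)" for j
  proof -
    have "\<bar>w j x\<bar>\<^sup>2 \<le> (2 * M)\<^sup>2" for x
      by (rule power_mono[OF w_le]) simp
    then have "(b j)\<^sup>2 \<le> (\<Sum>x\<in>?I. (2 * M)\<^sup>2)"
      unfolding b2 power2_abs by (rule sum_mono)
    also have "\<dots> = (2 * M * sqrt (real N))\<^sup>2" by (simp add: power_mult_distrib)
    finally show ?thesis by (rule power2_le_imp_le) (use M in simp)
  qed
  have lap: "w (Suc (Suc j)) x + w j x
      = 4 * w (Suc j) x - w (Suc j) ((x + 1) mod int N) - w (Suc j) ((x + - 1) mod int N)"
    if "x \<in> ?I" for j x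
    using harm[of "(x, J - int j)"] that
    by (simp add: mean_nbrs_eq Rle_def cyl_def w_def algebra_simps)
  have b0: "0 \<le> b j" for j by (simp add: b_def L2_set_nonneg)
  \<comment> \<open>The rate is chosen so that \<open>q + 1 / q\<close> exceeds 2 by at most the
    Poincare gap: the excess \<open>(1 - q)\<^sup>2 / q\<close> is at most
    \<open>4 * (1 - q)\<^sup>2\<close>, which is \<open>1 / (real N)\<^sup>2\<close>.\<close>
  define q where "q = 1 - 1 / (2 * real N)"
  have q: "q \<ge> 1 / 4" "q < 1" using N by (simp_all add: q_def field_simps)
  have q2: "q + 1 / q \<le> 2 + 1 / (real N)\<^sup>2"
  proof -
    have "q + 1 / q - 2 = (1 - q)\<^sup>2 / q" using q by (simp add: field_simps power2_eq_square)
    also have "\<dots> \<le> (1 - q)\<^sup>2 / (1 / 4)" using q by (intro divide_left_mono) auto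
    also have "\<dots> = 1 / (real N)\<^sup>2" using N by (simp add: q_def power2_eq_square)
    finally show ?thesis by simp
  qed
  have rec: "(q + 1 / q) * b (Suc j) \<le> b (Suc (Suc j)) + b j" for j
  proof (cases "b (Suc j) = 0")
    case True
    then show ?thesis using b0[of j] b0[of "Suc (Suc j)"] by simp
  next
    case False
    then have pos: "b (Suc j) > 0" using b0[of "Suc j"] by simp
    let ?g = "w (Suc j)"
    have rot: "(\<Sum>x\<in>?I. ?g x * ?g ((x + - 1) mod int N)) = (\<Sum>x\<in>?I. ?g x * ?g ((x + 1) mod int N))"
      using sum_rotate[OF N, of "\<lambda>x. ?g x * ?g ((x + - 1) mod int N)" 1]
      by (simp add: mod_simps mult.commute)
    have rot2: "(\<Sum>x\<in>?I. (?g ((x + 1) mod int N))\<^sup>2) = (\<Sum>x\<in>?I. (?g x)\<^sup>2)"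
      by (rule sum_rotate[OF N, of "\<lambda>x. (?g x)\<^sup>2"])
    \<comment> \<open>Pair the harmonic equation with the middle level and sum by parts. The
      Poincare inequality bounds the result below, Cauchy-Schwarz bounds it above, and one factor
      \<open>b (Suc j)\<close> cancels.\<close>
    have "(\<Sum>x\<in>?I. ?g x * w (Suc (Suc j)) x) + (\<Sum>x\<in>?I. ?g x * w j x)
        = (\<Sum>x\<in>?I. ?g x * (w (Suc (Suc j)) x + w j x))"
      by (simp add: sum.distrib algebra_simps)
    also have "\<dots> = (\<Sum>x\<in>?I. 4 * (?g x)\<^sup>2 - ?g x * ?g ((x + 1) mod int N) - ?g x * ?g ((x + - 1) mod int N))"
      by (intro sum.cong refl, subst lap) (auto simp: algebra_simps power2_eq_square)
    also have "\<dots> = 4 * (b (Suc j))\<^sup>2 - 2 * (\<Sum>x\<in>?I. ?g x * ?g ((x + 1) mod int N))"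
      by (simp add: sum_subtractf rot[simplified] b2 sum_distrib_left[symmetric])
    also have "\<dots> = 2 * (b (Suc j))\<^sup>2 + (\<Sum>x\<in>?I. (?g ((x + 1) mod int N) - ?g x)\<^sup>2)"
      using rot2 by (simp add: power2_diff sum.distrib sum_subtractf b2 sum_distrib_left algebra_simps)
    also have "\<dots> \<ge> 2 * (b (Suc j))\<^sup>2 + (b (Suc j))\<^sup>2 / (real N)\<^sup>2"
      using cycle_poincare[OF zero, of "Suc j"] N
      by (simp add: b2 field_simps)
    finally have "(2 + 1 / (real N)\<^sup>2) * (b (Suc j))\<^sup>2
        \<le> (\<Sum>x\<in>?I. ?g x * w (Suc (Suc j)) x) + (\<Sum>x\<in>?I. ?g x * w j x)"
      by (simp add: algebra_simps)
    also have "\<dots> \<le> b (Suc j) * b (Suc (Suc j)) + b (Suc j) * b j"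
    proof (rule add_mono)
      have "(\<Sum>x\<in>?I. ?g x * w k x) \<le> b (Suc j) * b k" for k
      proof -
        have "(\<Sum>x\<in>?I. ?g x * w k x) \<le> (\<Sum>x\<in>?I. \<bar>?g x\<bar> * \<bar>w k x\<bar>)"
          by (intro sum_mono) (metis abs_ge_self abs_mult)
        also have "\<dots> \<le> b (Suc j) * b k" unfolding b_def by (rule L2_set_mult_ineq)
        finally show ?thesis .
      qed
      then show "(\<Sum>x\<in>?I. ?g x * w (Suc (Suc j)) x) \<le> b (Suc j) * b (Suc (Suc j))"
        "(\<Sum>x\<in>?I. ?g x * w j x) \<le> b (Suc j) * b j" by auto
    qed
    finally have "b (Suc j) * ((2 + 1 / (real N)\<^sup>2) * b (Suc j)) \<le> b (Suc j) * (b (Suc (Suc j)) + b j)"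
      unfolding power2_eq_square distrib_left by (simp only: mult_ac)
    then have "(2 + 1 / (real N)\<^sup>2) * b (Suc j) \<le> b (Suc (Suc j)) + b j"
      by (rule mult_left_le_imp_le[OF _ pos])
    moreover have "(q + 1 / q) * b (Suc j) \<le> (2 + 1 / (real N)\<^sup>2) * b (Suc j)"
      using q2 pos by (intro mult_right_mono) auto
    ultimately show ?thesis by simp
  qed
  define j where "j = nat (J + 1 - y)"
  have "\<bar>f (x, y) - c\<bar> = \<bar>w j x\<bar>" using v by (simp add: w_def j_def)
  also have "\<dots> \<le> b j"
    using member_le_L2_set[of ?I x "\<lambda>x. \<bar>w j x\<bar>"] v by (simp add: b_def L2_set_def cyl_def)
  also have "\<dots> \<le> q ^ j * b 0"
    using q by (intro geometric_decay_of_bounded[where b = b, OF b0 b_le _ _ rec]) auto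
  also have "\<dots> \<le> q ^ j * (2 * M * sqrt (real N))" using q b_le by (intro mult_left_mono) auto
  finally show ?thesis by (simp add: c_def j_def q_def mult.commute)
qed

section \<open>Filling a flat cluster\<close>

text \<open>With \<open>z\<close> removed from the half cylinder, the walk exits either at
  \<open>z\<close> or just above level \<open>snd z\<close>, so hitting becomes exiting.\<close>

definition hit_prob :: "nat \<Rightarrow> site \<Rightarrow> site \<Rightarrow> real" where
  "hit_prob N z v = pmf (exit_pmf N (Rle N (snd z) - {z}) v) z"

lemma Rle_subset_Omega: "A \<in> Omega N \<Longrightarrow> Rle N 0 \<subseteq> A"
  by (auto simp: Omega_def)

lemma finite_box: "finite ({0..<int N} \<times> {1..k::int})"
  by simp

lemma Rle_minus_Omega:
  assumes "z \<in> cyl N" "snd z \<ge> 1"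
  shows "Rle N (snd z) - {z} \<in> Omega N"
proof -
  let ?F = "{0..<int N} \<times> {1..snd z} - {z}"
  have "Rle N (snd z) - {z} = Rle N 0 \<union> ?F"
    using assms(2) by (auto simp: Rle_def cyl_def)
  then show ?thesis
    unfolding Omega_def by (intro CollectI exI[of _ ?F]) (auto simp: cyl_def)
qed

locale hitting =
  fixes N :: nat and z :: site
  assumes N: "N \<ge> 3" and z: "z \<in> cyl N" "snd z \<ge> 1"
begin

abbreviation "\<phi> \<equiv> hit_prob N z"
abbreviation "k \<equiv> snd z"

text \<open>By \<open>level_sum_\<phi>\<close> this is also the average on level 0, that is, the
  hitting probability for a particle with uniform start.\<close>

definition "p = level_sum N \<phi> k / real N"

lemma \<phi>_nonneg: "0 \<le> \<phi> v" and \<phi>_le_1: "\<phi> v \<le> 1"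
  by (simp_all add: hit_prob_def pmf_le_1)

lemma \<phi>_bdd: "\<bar>\<phi> v\<bar> \<le> 1"
  using \<phi>_nonneg[of v] \<phi>_le_1[of v] by simp

lemma \<phi>_self: "\<phi> z = 1"
  by (simp add: hit_prob_def exit_pmf_outside)

lemma \<phi>_outside: "v \<notin> Rle N k \<Longrightarrow> \<phi> v = 0"
proof -
  assume v: "v \<notin> Rle N k"
  have "z \<in> Rle N k" using z by (cases z) (simp add: Rle_def)
  then have "v \<noteq> z" using v by blast
  then show ?thesis using v by (simp add: hit_prob_def exit_pmf_outside)
qed

lemma \<phi>_harmonic:
  assumes "v \<in> Rle N k" "v \<noteq> z"
  shows "\<phi> v = mean_nbrs N \<phi> v"
proof -
  have "v \<in> Rle N k - {z}" using assms by simp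
  from exit_pmf_step[OF N Rle_minus_Omega[OF z] this] show ?thesis
    using finite_dirs by (simp add: hit_prob_def pmf_bind_pmf_of_set mean_nbrs_def card_dirs)
qed

text \<open>Above level \<open>k\<close> the function vanishes and is nonnegative elsewhere.
  Subharmonicity there is what allows clusters reaching above \<open>z\<close>.\<close>

lemma \<phi>_subharmonic:
  assumes "v \<noteq> z"
  shows "\<phi> v \<le> mean_nbrs N \<phi> v"
proof (cases "v \<in> Rle N k")
  case False
  then show ?thesis by (simp add: \<phi>_outside mean_nbrs_def sum_nonneg \<phi>_nonneg)
qed (use \<phi>_harmonic assms in simp)

lemma \<phi>_harmonic_below: "v \<in> Rle N (k - 1) \<Longrightarrow> \<phi> v = mean_nbrs N \<phi> v"
  by (rule \<phi>_harmonic) (auto simp: Rle_def)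

lemma level_sum_\<phi>: "y \<le> k \<Longrightarrow> level_sum N \<phi> y = real N * p"
  using level_sum_const[where f = \<phi> and J = "k - 1", OF N \<phi>_bdd \<phi>_harmonic_below, of y] N
  by (simp add: p_def)

lemma p_ge: "1 \<le> real N * p"
proof -
  have "\<phi> (fst z, k) \<le> level_sum N \<phi> k"
    unfolding level_sum_def using z by (intro member_le_sum) (auto simp: cyl_def \<phi>_nonneg)
  then show ?thesis using N by (simp add: \<phi>_self p_def)
qed

lemma p_pos: "0 < p"
  using p_ge N by (metis less_le_trans of_nat_0_le_iff zero_less_mult_pos2 zero_less_one mult.commute not_le mult_nonneg_nonpos)

lemma p_le_1: "p \<le> 1"
  using abs_level_sum_le[of \<phi> 1 N k, OF \<phi>_bdd] N by (simp add: p_def)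

definition "D v = p - \<phi> v"

lemma D_bdd: "\<bar>D v\<bar> \<le> 1"
  using \<phi>_nonneg[of v] \<phi>_le_1[of v] p_pos p_le_1 by (simp add: D_def abs_le_iff)

lemma abs_D_le:
  assumes "(x, y) \<in> cyl N" "y \<le> k"
  shows "\<bar>D (x, y)\<bar> \<le> 2 * sqrt (real N) * (1 - 1 / (2 * real N)) ^ nat (k - y)"
  using harmonic_mixing[where f = \<phi> and J = "k - 1", OF N \<phi>_bdd \<phi>_harmonic_below, of x y] assms
  by (simp add: D_def p_def abs_minus_commute)

lemma level_sum_abs_D:
  assumes "y \<le> k"
  shows "level_sum N (\<lambda>v. \<bar>D v\<bar>) y \<le> 2 * (real N * p)"
proof -
  have "level_sum N (\<lambda>v. \<bar>D v\<bar>) y \<le> level_sum N (\<lambda>v. p + \<phi> v) y"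
    unfolding level_sum_def D_def using p_pos \<phi>_nonneg
    by (intro sum_mono) (simp add: abs_le_iff order_trans[OF _ add_increasing])
  also have "\<dots> = real N * p + level_sum N \<phi> y"
    by (simp add: level_sum_def sum.distrib)
  finally show ?thesis using level_sum_\<phi>[OF assms] by simp
qed

text \<open>The top \<open>L\<close> levels contribute at most \<open>2 * (real N * p)\<close> each.
  Below them mixing applies, and the hypothesis keeps the sum over all these levels within 1, hence
  within \<open>real N * p\<close>.\<close>

lemma sum_abs_D:
  fixes L :: nat
  assumes L: "2 * real N * sqrt (real N) * (1 - 1 / (2 * real N)) ^ L * real_of_int k \<le> 1"
  shows "(\<Sum>v\<in>{0..<int N} \<times> {1..k}. \<bar>D v\<bar>) \<le> real N * p * (2 * real L + 1)"
proof -
  let ?q = "1 - 1 / (2 * real N)" and ?S = "level_sum N (\<lambda>v. \<bar>D v\<bar>)"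
  have q: "0 \<le> ?q" "?q \<le> 1" using N by (auto simp: field_simps)
  define \<epsilon> where "\<epsilon> = 2 * real N * sqrt (real N) * ?q ^ L"
  have eps: "0 \<le> \<epsilon>" using q by (simp add: \<epsilon>_def)
  have le: "?S y \<le> \<epsilon> + (if k - int L < y then 2 * (real N * p) else 0)" if y: "y \<le> k" for y
  proof (cases "k - int L < y")
    case True
    then show ?thesis using level_sum_abs_D[OF y] eps by simp
  next
    case False
    have "?S y \<le> (\<Sum>x\<in>{0..<int N}. 2 * sqrt (real N) * ?q ^ L)"
      unfolding level_sum_def
    proof (rule sum_mono)
      fix x assume "x \<in> {0..<int N}"
      then have "\<bar>D (x, y)\<bar> \<le> 2 * sqrt (real N) * ?q ^ nat (k - y)"
        using y by (intro abs_D_le) (auto simp: cyl_def)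
      also have "\<dots> \<le> 2 * sqrt (real N) * ?q ^ L"
        using False q by (intro mult_left_mono power_decreasing) auto
      finally show "\<bar>D (x, y)\<bar> \<le> 2 * sqrt (real N) * ?q ^ L" .
    qed
    then show ?thesis using False by (simp add: \<epsilon>_def)
  qed
  have "(\<Sum>v\<in>{0..<int N} \<times> {1..k}. \<bar>D v\<bar>) = (\<Sum>y\<in>{1..k}. ?S y)"
    unfolding level_sum_def
    by (subst sum.swap) (simp add: sum.cartesian_product)
  also have "\<dots> \<le> (\<Sum>y\<in>{1..k}. \<epsilon> + (if k - int L < y then 2 * (real N * p) else 0))"
    by (intro sum_mono le) auto
  also have "\<dots> = real_of_int k * \<epsilon> + real (card {y \<in> {1..k}. k - int L < y}) * (2 * (real N * p))"
    using z by (simp add: sum.distrib sum.inter_filter[symmetric])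
  also have "\<dots> \<le> 1 + real L * (2 * (real N * p))"
  proof (intro add_mono mult_right_mono)
    show "real_of_int k * \<epsilon> \<le> 1" using L by (simp add: \<epsilon>_def mult_ac)
    have "card {y \<in> {1..k}. k - int L < y} \<le> card {k - int L<..k}"
      by (intro card_mono) auto
    then show "real (card {y \<in> {1..k}. k - int L < y}) \<le> real L" by simp
  qed (use p_pos in auto)
  also have "\<dots> \<le> real N * p * (2 * real L + 1)" using p_ge by (simp add: algebra_simps)
  finally show ?thesis .
qed

section \<open>The exponential supermartingale\<close>

definition "g v = D v / 4 - (D v)\<^sup>2 / 8"

text \<open>With \<open>x = D v / 4\<close> the exponent is \<open>x - 2 * x\<^sup>2\<close>, a
  lower bound of \<open>ln (1 + x)\<close> for small \<open>x\<close> of either sign. The quadratic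
  correction thus leaves a bound linear in \<open>D\<close>, whose mean can be controlled.\<close>

lemma exp_g_le: "exp (g v) \<le> 1 + D v / 4"
proof -
  define x where "x = D v / 4"
  have x: "\<bar>x\<bar> \<le> 1 / 4" using D_bdd[of v] by (simp add: x_def)
  have "x - 2 * x\<^sup>2 \<le> ln (1 + x)"
  proof (cases "0 \<le> x")
    case True
    have "x - x\<^sup>2 \<le> ln (1 + x)" using True x by (intro ln_one_plus_pos_lower_bound) auto
    then show ?thesis by (smt (verit) zero_le_power2)
  next
    case False
    then show ?thesis using ln_one_minus_pos_lower_bound[of "- x"] x by simp
  qed
  moreover have "g v = x - 2 * x\<^sup>2" by (simp add: g_def x_def power2_eq_square)
  ultimately have "exp (g v) \<le> exp (ln (1 + x))" by simp
  also have "\<dots> = 1 + x" using x by (intro exp_ln) (simp add: abs_le_iff)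
  finally show ?thesis by (simp add: x_def)
qed

lemma g_ge: "g v \<ge> - \<bar>D v\<bar> / 2"
proof -
  have "(D v)\<^sup>2 \<le> \<bar>D v\<bar>"
    using D_bdd[of v] mult_left_le_one_le[of "\<bar>D v\<bar>" "\<bar>D v\<bar>"] by (simp add: power2_eq_square)
  then show ?thesis unfolding g_def by linarith
qed

lemma g_ge_above: "v \<notin> Rle N k \<Longrightarrow> g v \<ge> p / 8"
proof -
  assume "v \<notin> Rle N k"
  then have "D v = p" by (simp add: D_def \<phi>_outside)
  moreover have "p\<^sup>2 \<le> p" using p_pos p_le_1 by (simp add: power2_eq_square mult_left_le_one_le)
  ultimately show ?thesis by (simp add: g_def)
qed

text \<open>Killed once \<open>z\<close> is occupied, since the drift of \<open>D\<close> is
  controlled only while \<open>z\<close> is empty.\<close>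

definition \<Psi> :: "site set \<Rightarrow> real" where
  "\<Psi> A = (if z \<in> A then 0 else exp (\<Sum>v\<in>{(x, y) \<in> A. y > 0}. g v))"

lemma \<Psi>_nonneg: "0 \<le> \<Psi> A"
  by (simp add: \<Psi>_def)

lemma \<Psi>_insert:
  assumes A: "A \<in> Omega N" and w: "w \<notin> A" "w \<in> cyl N"
  shows "\<Psi> (insert w A) \<le> \<Psi> A * (1 + D w / 4)"
proof (cases "z \<in> insert w A")
  case True
  have "0 \<le> 1 + D w / 4" using D_bdd[of w] by (simp add: abs_le_iff)
  with True show ?thesis using \<Psi>_nonneg[of A] by (simp add: \<Psi>_def)
next
  case False
  have "snd w > 0" using w Rle_subset_Omega[OF A] by (cases w) (force simp: Rle_def)
  then have "{(x, y) \<in> insert w A. y > 0} = insert w {(x, y) \<in> A. y > 0}" by auto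
  moreover have "w \<notin> {(x, y) \<in> A. y > 0}" using w by auto
  ultimately have "(\<Sum>v\<in>{(x, y) \<in> insert w A. y > 0}. g v) = g w + (\<Sum>v\<in>{(x, y) \<in> A. y > 0}. g v)"
    by (simp only: sum.insert[OF finite_above_0[OF A]] not_False_eq_True)
  then have "\<Psi> (insert w A) = \<Psi> A * exp (g w)"
    using False by (simp only: \<Psi>_def exp_add) simp
  also have "\<dots> \<le> \<Psi> A * (1 + D w / 4)" by (intro mult_left_mono exp_g_le \<Psi>_nonneg)
  finally show ?thesis .
qed

text \<open>While \<open>z\<close> is unoccupied, \<open>\<phi>\<close> is subharmonic along the stopped walks; this makes \<open>\<Psi>\<close> a
  supermartingale.\<close>
lemma \<Psi>_step:
  assumes A: "A \<in> Omega N"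
  shows "(\<integral>\<^sup>+B. ennreal (\<Psi> B) \<partial>idla_step N A) \<le> ennreal (\<Psi> A)"
proof (cases "z \<in> A")
  case True
  have "(\<integral>\<^sup>+B. ennreal (\<Psi> B) \<partial>idla_step N A) = (\<integral>\<^sup>+B. 0 \<partial>idla_step N A)"
  proof (intro nn_integral_cong_AE AE_pmfI)
    fix B assume "B \<in> set_pmf (idla_step N A)"
    then have "A \<subseteq> B"
      using set_idla_step[OF N A] set_add_particle(2)[OF N A] level_subset_cyl by blast
    then show "ennreal (\<Psi> B) = 0" using True by (auto simp: \<Psi>_def)
  qed
  then show ?thesis by simp
next
  case False
  define \<mu> where "\<mu> = pmf_of_set (level N 0) \<bind> exit_pmf N A"
  have mu: "w \<notin> A" "w \<in> cyl N" if "w \<in> set_pmf \<mu>" for w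
  proof -
    obtain v where "v \<in> level N 0" "w \<in> set_pmf (exit_pmf N A v)"
      using \<open>w \<in> set_pmf \<mu>\<close> level_0[OF N] by (auto simp: \<mu>_def set_pmf_of_set)
    then show "w \<notin> A" "w \<in> cyl N"
      using set_exit_pmf[OF N A] set_exit_pmf_cyl[OF N] level_subset_cyl by blast+
  qed
  have step: "idla_step N A = map_pmf (\<lambda>w. insert w A) \<mu>"
    by (simp add: idla_step_def \<mu>_def add_particle_def[abs_def] map_bind_pmf)
  \<comment> \<open>Uniform starts on level 0 have mean \<open>p\<close>, and optional stopping can
    only raise the mean of \<open>\<phi>\<close>; hence \<open>D\<close> has mean at most 0 at the
    settling site.\<close>
  have "p = level_sum N \<phi> 0 / real N" using level_sum_\<phi>[of 0] z N by simp
  also have "\<dots> = (\<Sum>v\<in>level N 0. \<phi> v) / real N"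
    using sum.cartesian_product[of "\<lambda>x y. \<phi> (x, y)" "{0 :: int}" "{0..<int N}"]
    by (simp add: level_sum_def level_def)
  also have "\<dots> \<le> (\<Sum>v\<in>level N 0. measure_pmf.expectation (exit_pmf N A v) \<phi>) / real N"
    using False level_subset_cyl
    by (intro divide_right_mono sum_mono optional_stopping[OF N A _ \<phi>_bdd] \<phi>_subharmonic) auto
  also have "\<dots> = measure_pmf.expectation \<mu> \<phi>"
    unfolding \<mu>_def expectation_bind_pmf[of \<phi>, OF \<phi>_bdd]
    using level_0[OF N] by (simp add: integral_pmf_of_set card_level)
  finally have p_le: "p \<le> measure_pmf.expectation \<mu> \<phi>" .
  have int: "integrable \<mu> \<phi>" by (rule integrable_bounded_pmf[OF \<phi>_bdd])
  have D0: "0 \<le> 1 + D w / 4" for w using D_bdd[of w] by (simp add: abs_le_iff)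
  have "(\<integral>\<^sup>+B. ennreal (\<Psi> B) \<partial>idla_step N A) = (\<integral>\<^sup>+w. ennreal (\<Psi> (insert w A)) \<partial>\<mu>)"
    by (simp add: step)
  also have "\<dots> \<le> (\<integral>\<^sup>+w. ennreal (\<Psi> A) * ennreal (1 + D w / 4) \<partial>\<mu>)"
  proof (intro nn_integral_mono_AE AE_pmfI)
    fix w assume "w \<in> set_pmf \<mu>"
    from \<Psi>_insert[OF A mu[OF this]] show "ennreal (\<Psi> (insert w A)) \<le> ennreal (\<Psi> A) * ennreal (1 + D w / 4)"
      by (simp add: ennreal_mult[symmetric] \<Psi>_nonneg D0 ennreal_leI)
  qed
  also have "\<dots> = ennreal (\<Psi> A) * (\<integral>\<^sup>+w. ennreal (1 + D w / 4) \<partial>\<mu>)"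
    by (rule nn_integral_cmult) simp
  also have "(\<integral>\<^sup>+w. ennreal (1 + D w / 4) \<partial>\<mu>) = ennreal (measure_pmf.expectation \<mu> (\<lambda>w. 1 + D w / 4))"
    using int D0 by (intro nn_integral_eq_integral) (auto simp: D_def)
  also have "measure_pmf.expectation \<mu> (\<lambda>w. 1 + D w / 4) = 1 + (p - measure_pmf.expectation \<mu> \<phi>) / 4"
    using int by (simp add: D_def)
  also have "ennreal (\<Psi> A) * ennreal (1 + (p - measure_pmf.expectation \<mu> \<phi>) / 4) \<le> ennreal (\<Psi> A) * ennreal 1"
    using p_le by (intro mult_left_mono ennreal_leI) auto
  finally show ?thesis by simp
qed

lemma \<Psi>_idla_pmf:
  assumes "A \<in> Omega N"
  shows "(\<integral>\<^sup>+B. ennreal (\<Psi> B) \<partial>idla_pmf N t A) \<le> ennreal (\<Psi> A)"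
  using assms
proof (induction t arbitrary: A)
  case (Suc t)
  have "(\<integral>\<^sup>+B. ennreal (\<Psi> B) \<partial>idla_pmf N (Suc t) A)
      = (\<integral>\<^sup>+C. \<integral>\<^sup>+B. ennreal (\<Psi> B) \<partial>idla_pmf N t C \<partial>idla_step N A)" by simp
  also have "\<dots> \<le> (\<integral>\<^sup>+C. ennreal (\<Psi> C) \<partial>idla_step N A)"
    using set_idla_step_Omega[OF N Suc.prems]
    by (intro nn_integral_mono_AE AE_pmfI Suc.IH)
  also have "\<dots> \<le> ennreal (\<Psi> A)" by (rule \<Psi>_step[OF Suc.prems])
  finally show ?case .
qed simp

end

text \<open>The exit site is almost surely a new site above level 0, so every step adds exactly
  one.\<close>

lemma cluster_size_idla_pmf:
  assumes N: "N \<ge> 3" and "A \<in> Omega N" "B \<in> set_pmf (idla_pmf N t A)"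
  shows "cluster_size B = cluster_size A + t"
  using assms(2-)
proof (induction t arbitrary: A)
  case (Suc t)
  then obtain C where C: "C \<in> set_pmf (idla_step N A)" "B \<in> set_pmf (idla_pmf N t C)" by auto
  from set_idla_step[OF N Suc.prems(1) C(1)] obtain v w where
    v: "v \<in> level N 0" and w: "w \<in> set_pmf (exit_pmf N A v)" and Cw: "C = insert w A"
    by (auto simp: add_particle_def)
  have wA: "w \<notin> A" using set_exit_pmf[OF N Suc.prems(1)] w by blast
  moreover have "w \<in> cyl N" using set_exit_pmf_cyl[OF N] v w level_subset_cyl by blast
  ultimately have "snd w > 0"
    using Rle_subset_Omega[OF Suc.prems(1)] by (cases w) (force simp: Rle_def)
  then have "{(x, y) \<in> C. y > 0} = insert w {(x, y) \<in> A. y > 0}" using Cw by auto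
  moreover have "w \<notin> {(x, y) \<in> A. y > 0}" using wA by auto
  ultimately have "cluster_size C = Suc (cluster_size A)"
    by (simp only: cluster_size_def card_insert_disjoint[OF finite_above_0[OF Suc.prems(1)]] not_False_eq_True)
  then show ?case
    using Suc.IH[OF set_idla_step_Omega[OF N Suc.prems(1) C(1)] C(2)] by simp
qed simp

text \<open>The box up to level \<open>k\<close> holds at most \<open>k * N\<close> sites, so at
  least \<open>8 * N * (L + 1 + T)\<close> lie above it, each worth \<open>p / 8\<close> or more: in
  total \<open>N * p * (L + 1 + T)\<close>. The box costs at most half of
  \<open>N * p * (2 * L + 1)\<close>, and \<open>N * p \<ge> 1\<close> leaves more than
  \<open>T\<close>.\<close>

lemma (in hitting) sum_g_ge:
  fixes L :: nat
  assumes L: "2 * real N * sqrt (real N) * (1 - 1 / (2 * real N)) ^ L * real_of_int k \<le> 1"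
    and B: "B \<in> Omega N" and T: "T \<ge> 0"
    and t: "real (cluster_size B) \<ge> real_of_int k * real N + 8 * real N * (real L + 1 + T)"
  shows "T \<le> (\<Sum>v\<in>{(x, y) \<in> B. y > 0}. g v)"
proof -
  let ?Up = "{(x, y) \<in> B. y > 0}" and ?box = "{0..<int N} \<times> {1..k}"
  let ?Lo = "?Up \<inter> ?box" and ?Hi = "?Up - ?box"
  have fin: "finite ?Up" by (rule finite_above_0[OF B])
  have "real (card ?Lo) \<le> real (card ?box)"
    by (intro of_nat_mono card_mono finite_box) auto
  also have "\<dots> = real_of_int k * real N" using z by simp
  finally have "real (cluster_size B) - real_of_int k * real N \<le> real (card ?Hi)"
    using card_Int_Diff[OF fin, of ?box] by (simp add: cluster_size_def)
  then have hi: "8 * real N * (real L + 1 + T) \<le> real (card ?Hi)" using t by linarith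
  have "real N * p * (real L + 1 + T) = (8 * real N * (real L + 1 + T)) * (p / 8)" by simp
  also have "\<dots> \<le> real (card ?Hi) * (p / 8)" using hi p_pos by (intro mult_right_mono) auto
  also have "\<dots> = (\<Sum>v\<in>?Hi. p / 8)" by simp
  also have "\<dots> \<le> (\<Sum>v\<in>?Hi. g v)"
  proof (intro sum_mono g_ge_above)
    fix v assume "v \<in> ?Hi"
    then show "v \<notin> Rle N k" by (auto simp: Rle_def cyl_def)
  qed
  finally have 1: "real N * p * (real L + 1 + T) \<le> (\<Sum>v\<in>?Hi. g v)" .
  have "(\<Sum>v\<in>?Lo. \<bar>D v\<bar>) \<le> (\<Sum>v\<in>?box. \<bar>D v\<bar>)"
    by (intro sum_mono2 finite_box) auto
  also have "\<dots> \<le> real N * p * (2 * real L + 1)" by (rule sum_abs_D[OF L])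
  finally have "- (real N * p * (2 * real L + 1)) / 2 \<le> (\<Sum>v\<in>?Lo. - \<bar>D v\<bar> / 2)"
    by (simp add: sum_divide_distrib[symmetric] sum_negf)
  also have "\<dots> \<le> (\<Sum>v\<in>?Lo. g v)" by (intro sum_mono g_ge)
  finally have 2: "- (real N * p * (2 * real L + 1)) / 2 \<le> (\<Sum>v\<in>?Lo. g v)" .
  have "T \<le> real N * p * T" using p_ge T mult_right_mono[of 1 "real N * p" T] by simp
  also have "\<dots> \<le> real N * p * (real L + 1 + T) - real N * p * (2 * real L + 1) / 2"
    using p_ge by (simp add: algebra_simps)
  also have "\<dots> \<le> (\<Sum>v\<in>?Hi. g v) + (\<Sum>v\<in>?Lo. g v)" using 1 2 by simp
  also have "\<dots> = (\<Sum>v\<in>?Up. g v)"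
    using sum.Int_Diff[OF fin, of g ?box] by simp
  finally show ?thesis .
qed

text \<open>Markov's inequality: \<open>\<Psi>\<close> is at least \<open>exp T\<close> when
  \<open>z\<close> is empty, while its mean stays below its initial value 1.\<close>

lemma (in hitting) prob_unoccupied:
  fixes L :: nat
  assumes L: "2 * real N * sqrt (real N) * (1 - 1 / (2 * real N)) ^ L * real_of_int k \<le> 1"
    and T: "T \<ge> 0" and t: "real t \<ge> real_of_int k * real N + 8 * real N * (real L + 1 + T)"
  shows "measure_pmf.prob (idla_pmf N t (Rle N 0)) {B. z \<notin> B} \<le> exp (- T)"
proof -
  let ?P = "idla_pmf N t (Rle N 0)"
  have R0: "Rle N 0 \<in> Omega N" unfolding Omega_def by blast
  have up0: "{(x, y) \<in> Rle N 0. y > 0} = {}" by (auto simp: Rle_def)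
  have "ennreal (exp T) * emeasure ?P {B. z \<notin> B} = (\<integral>\<^sup>+B. ennreal (exp T) * indicator {B. z \<notin> B} B \<partial>?P)"
    by (simp add: nn_integral_cmult)
  also have "\<dots> \<le> (\<integral>\<^sup>+B. ennreal (\<Psi> B) \<partial>?P)"
  proof (intro nn_integral_mono_AE AE_pmfI)
    fix B assume B: "B \<in> set_pmf ?P"
    have "cluster_size B = t"
      using cluster_size_idla_pmf[OF N R0 B] up0 by (simp add: cluster_size_def)
    then have "T \<le> (\<Sum>v\<in>{(x, y) \<in> B. y > 0}. g v)"
      using t by (intro sum_g_ge[OF L set_idla_pmf_Omega[OF N R0 B] T]) simp
    then show "ennreal (exp T) * indicator {B. z \<notin> B} B \<le> ennreal (\<Psi> B)"
      by (auto simp: \<Psi>_def indicator_def intro!: ennreal_leI)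
  qed
  also have "\<dots> \<le> ennreal (\<Psi> (Rle N 0))" by (rule \<Psi>_idla_pmf[OF R0])
  also have "\<Psi> (Rle N 0) \<le> 1" unfolding \<Psi>_def up0 by simp
  finally have "ennreal (exp T * measure_pmf.prob ?P {B. z \<notin> B}) \<le> ennreal 1"
    by (simp add: measure_pmf.emeasure_eq_measure ennreal_mult' ennreal_leI order_trans)
  then have "exp T * measure_pmf.prob ?P {B. z \<notin> B} \<le> 1" by simp
  then show ?thesis by (simp add: exp_minus field_simps)
qed

text \<open>Union bound over the sites of levels 1 to \<open>H\<close>; the conditions on
  \<open>L\<close> and \<open>t\<close> are most demanding at level \<open>H\<close>.\<close>

lemma prob_not_filled:
  fixes L :: nat
  assumes N: "N \<ge> 3"
    and L: "2 * real N * sqrt (real N) * (1 - 1 / (2 * real N)) ^ L * real_of_int H \<le> 1"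
    and H: "H \<ge> 0"
    and T: "T \<ge> 0" and t: "real t \<ge> real_of_int H * real N + 8 * real N * (real L + 1 + T)"
  shows "measure_pmf.prob (idla_pmf N t (Rle N 0)) {B. \<not> Rle N H \<subseteq> B} \<le> real N * real_of_int H * exp (- T)"
proof -
  let ?P = "idla_pmf N t (Rle N 0)" and ?box = "{0..<int N} \<times> {1..H}"
  have R0: "Rle N 0 \<in> Omega N" unfolding Omega_def by blast
  have q: "0 \<le> 1 - 1 / (2 * real N)" using N by (simp add: field_simps)
  have "measure_pmf.prob ?P {B. \<not> Rle N H \<subseteq> B} \<le> measure_pmf.prob ?P (\<Union>z\<in>?box. {B. z \<notin> B})"
  proof (intro measure_pmf.finite_measure_mono_AE AE_pmfI impI)
    fix B assume B: "B \<in> set_pmf ?P" "B \<in> {B. \<not> Rle N H \<subseteq> B}"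
    have "Rle N 0 \<subseteq> B" by (rule Rle_subset_Omega[OF set_idla_pmf_Omega[OF N R0 B(1)]])
    then show "B \<in> (\<Union>z\<in>?box. {B. z \<notin> B})"
      using B(2) by (force simp: Rle_def cyl_def)
  qed simp
  also have "\<dots> \<le> (\<Sum>z\<in>?box. measure_pmf.prob ?P {B. z \<notin> B})"
    by (intro measure_pmf.finite_measure_subadditive_finite) auto
  also have "\<dots> \<le> (\<Sum>z\<in>?box. exp (- T))"
  proof (rule sum_mono)
    fix z assume zb: "z \<in> ?box"
    then interpret hitting N z by unfold_locales (use N in \<open>auto simp: cyl_def\<close>)
    have kH: "real_of_int (snd z) \<le> real_of_int H" using zb by auto
    have "2 * real N * sqrt (real N) * (1 - 1 / (2 * real N)) ^ L * real_of_int (snd z)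
        \<le> 2 * real N * sqrt (real N) * (1 - 1 / (2 * real N)) ^ L * real_of_int H"
      using kH q by (intro mult_left_mono) auto
    also note L
    finally show "measure_pmf.prob ?P {B. z \<notin> B} \<le> exp (- T)"
      using t mult_right_mono[OF kH, of "real N"]
      by (intro prob_unoccupied[OF _ T]) auto
  qed
  also have "\<dots> = real N * real_of_int H * exp (- T)" using H by simp
  finally show ?thesis .
qed

section \<open>Comparison of two processes\<close>

text \<open>The expected value of \<open>f\<close> at the exit site is harmonic on
  \<open>R_H\<close> in the start, so at depth \<open>L\<close> it is close to its level average;
  the two starts are compared through that average.\<close>

lemma expectation_exit_pmf_close:
  fixes f :: "site \<Rightarrow> real"
  assumes N: "N \<ge> 3" and A: "A \<in> Omega N" "Rle N H \<subseteq> A" and bdd: "\<And>v. \<bar>f v\<bar> \<le> 1"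
    and a: "a \<in> cyl N" "snd a + int L \<le> H" and b: "b \<in> cyl N" "snd b + int L \<le> H"
  shows "\<bar>measure_pmf.expectation (exit_pmf N A a) f - measure_pmf.expectation (exit_pmf N A b) f\<bar>
       \<le> 4 * sqrt (real N) * (1 - 1 / (2 * real N)) ^ L"
proof -
  define u where "u v = measure_pmf.expectation (exit_pmf N A v) f" for v
  let ?q = "1 - 1 / (2 * real N)"
  have q: "0 \<le> ?q" "?q \<le> 1" using N by (auto simp: field_simps)
  have u_bdd: "\<bar>u v\<bar> \<le> 1" for v unfolding u_def by (rule expectation_bounded_pmf[OF bdd])
  have harm: "u v = mean_nbrs N u v" if "v \<in> Rle N H" for v
  proof -
    have "v \<in> A" using that A(2) by blast
    from expectation_exit_pmf_step[where f = f, OF N A(1) this bdd] show ?thesis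
      by (simp add: u_def[abs_def])
  qed
  define c where "c = level_sum N u (H + 1) / real N"
  have "\<bar>u v - c\<bar> \<le> 2 * sqrt (real N) * ?q ^ L" if v: "v \<in> cyl N" "snd v + int L \<le> H" for v
  proof -
    have "\<bar>u (fst v, snd v) - c\<bar> \<le> 2 * 1 * sqrt (real N) * ?q ^ nat (H + 1 - snd v)"
      unfolding c_def using v by (intro harmonic_mixing[where f = u, OF N u_bdd harm]) auto
    also have "\<dots> \<le> 2 * 1 * sqrt (real N) * ?q ^ L"
      using v q by (intro mult_left_mono power_decreasing) auto
    finally show ?thesis by simp
  qed
  from this[OF a] this[OF b] show ?thesis unfolding u_def by linarith
qed

lemma prob_bind_pmf:
  "measure_pmf.prob (p \<bind> q) S = measure_pmf.expectation p (\<lambda>x. measure_pmf.prob (q x) S)"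
  using expectation_bind_pmf[of "indicator S :: _ \<Rightarrow> real" 1 p q] by (simp add: indicator_def)

text \<open>Exchange one start at a time. Each exchange costs one mixing error, and the growing
  cluster keeps containing \<open>R_H\<close>.\<close>

lemma add_particles_close:
  assumes N: "N \<ge> 3" and A: "A \<in> Omega N" "Rle N H \<subseteq> A" and len: "length as = length bs"
    and as: "\<And>v. v \<in> set as \<Longrightarrow> v \<in> cyl N \<and> snd v + int L \<le> H"
    and bs: "\<And>v. v \<in> set bs \<Longrightarrow> v \<in> cyl N \<and> snd v + int L \<le> H"
  shows "\<bar>measure_pmf.prob (add_particles N as A) S - measure_pmf.prob (add_particles N bs A) S\<bar>
       \<le> real (length as) * (4 * sqrt (real N) * (1 - 1 / (2 * real N)) ^ L)"
  using len A as bs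
proof (induction as bs arbitrary: A rule: list_induct2)
  case (Cons a as b bs)
  let ?\<epsilon> = "4 * sqrt (real N) * (1 - 1 / (2 * real N)) ^ L"
  define F where "F vs z = measure_pmf.prob (add_particles N vs (insert z A)) S" for vs z
  have F: "measure_pmf.prob (add_particles N (v # vs) A) S = measure_pmf.expectation (exit_pmf N A v) (F vs)"
    for v vs
    by (simp add: add_particle_def bind_map_pmf prob_bind_pmf F_def[abs_def])
  have F_bdd: "\<bar>F vs z\<bar> \<le> 1" for vs z by (simp add: F_def measure_nonneg measure_pmf.prob_le_1)
  have int: "integrable (exit_pmf N A v) (F vs)" for v vs
    by (rule integrable_bounded_pmf[OF F_bdd])
  have a: "a \<in> cyl N" "snd a + int L \<le> H" and b: "b \<in> cyl N" "snd b + int L \<le> H"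
    using Cons.prems by auto
  have "\<bar>measure_pmf.expectation (exit_pmf N A a) (F as) - measure_pmf.expectation (exit_pmf N A a) (F bs)\<bar>
      = \<bar>measure_pmf.expectation (exit_pmf N A a) (\<lambda>z. F as z - F bs z)\<bar>"
    using int by simp
  also have "\<dots> \<le> measure_pmf.expectation (exit_pmf N A a) (\<lambda>z. \<bar>F as z - F bs z\<bar>)"
    by (rule integral_abs_bound)
  also have "\<dots> \<le> real (length as) * ?\<epsilon>"
  proof (rule measure_pmf.integral_le_const)
    show "integrable (exit_pmf N A a) (\<lambda>z. \<bar>F as z - F bs z\<bar>)" using int by simp
    show "AE z in exit_pmf N A a. \<bar>F as z - F bs z\<bar> \<le> real (length as) * ?\<epsilon>"
    proof (rule AE_pmfI)
      fix z assume z: "z \<in> set_pmf (exit_pmf N A a)"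
      show "\<bar>F as z - F bs z\<bar> \<le> real (length as) * ?\<epsilon>"
        unfolding F_def
        using Cons.prems insert_exit_pmf_Omega[OF N Cons.prems(1) a(1) z]
        by (intro Cons.IH) auto
    qed
  qed
  finally have "\<bar>measure_pmf.expectation (exit_pmf N A a) (F as)
      - measure_pmf.expectation (exit_pmf N A a) (F bs)\<bar> \<le> real (length as) * ?\<epsilon>" .
  moreover have "\<bar>measure_pmf.expectation (exit_pmf N A a) (F bs)
      - measure_pmf.expectation (exit_pmf N A b) (F bs)\<bar> \<le> ?\<epsilon>"
    by (rule expectation_exit_pmf_close[OF N Cons.prems(1,2) F_bdd a b])
  ultimately have "\<bar>measure_pmf.expectation (exit_pmf N A a) (F as)
      - measure_pmf.expectation (exit_pmf N A b) (F bs)\<bar> \<le> real (length as) * ?\<epsilon> + ?\<epsilon>"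
    by linarith
  then show ?case unfolding F by (simp add: distrib_right)
qed simp

text \<open>\<open>A\<close> arises from the flat cluster by releasing one particle on each of its
  sites above level 0; these releases commute with the \<open>t\<close> steps.\<close>

lemma idla_pmf_decompose:
  assumes N: "N \<ge> 3" and A: "A \<in> Omega N"
  shows "\<exists>vs. length vs = cluster_size A \<and> set vs = {(x, y) \<in> A. y > 0} \<and>
    (\<forall>t. idla_pmf N t A = idla_pmf N t (Rle N 0) \<bind> add_particles N vs)"
proof -
  let ?Up = "{(x, y) \<in> A. y > 0}"
  have R0: "Rle N 0 \<in> Omega N" unfolding Omega_def by blast
  obtain vs where vs: "set vs = ?Up" "distinct vs"
    using finite_distinct_list[OF finite_above_0[OF A]] by blast
  have len: "length vs = cluster_size A"
    using distinct_card[OF vs(2)] vs(1) by (simp add: cluster_size_def)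
  have "A \<subseteq> cyl N" by (rule Omega_subset_cyl[OF A])
  then have "Rle N 0 \<union> ?Up = A" "set vs \<subseteq> cyl N"
    using Rle_subset_Omega[OF A] vs(1) by (auto simp: Rle_def)
  moreover have "set vs \<inter> Rle N 0 = {}" using vs(1) by (auto simp: Rle_def)
  ultimately have "idla_pmf N t A = idla_pmf N t (Rle N 0) \<bind> add_particles N vs" for t
    using idla_pmf_add_particles[OF N R0, of vs t] vs
    by (simp add: add_particles_outside bind_return_pmf)
  with len vs(1) show ?thesis by blast
qed

text \<open>Both laws start from the same flat process and differ only in the particles released
  afterwards. If \<open>R_H\<close> is filled, with \<open>H = h + L\<close>, these start at depth
  at least \<open>L\<close> and can be exchanged; otherwise the difference is bounded by 1.\<close>

lemma prob_idla_pmf_close: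
  fixes L :: nat and h :: int
  assumes N: "N \<ge> 3" and A: "A \<in> Omega N" and A': "A' \<in> Omega N"
    and size: "cluster_size A = cluster_size A'"
    and h: "cluster_height A \<le> h" "cluster_height A' \<le> h"
    and L: "2 * real N * sqrt (real N) * (1 - 1 / (2 * real N)) ^ L * real_of_int (h + int L) \<le> 1"
    and T: "T \<ge> 0" and t: "real t \<ge> real_of_int (h + int L) * real N + 8 * real N * (real L + 1 + T)"
  shows "\<bar>measure_pmf.prob (idla_pmf N t A) S - measure_pmf.prob (idla_pmf N t A') S\<bar>
      \<le> real N * real_of_int (h + int L) * exp (- T)
        + real (cluster_size A) * (4 * sqrt (real N) * (1 - 1 / (2 * real N)) ^ L)"
proof -
  define H where "H = h + int L"
  define \<epsilon> where "\<epsilon> = real (cluster_size A) * (4 * sqrt (real N) * (1 - 1 / (2 * real N)) ^ L)"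
  define P where "P = idla_pmf N t (Rle N 0)"
  have R0: "Rle N 0 \<in> Omega N" unfolding Omega_def by blast
  have q: "0 \<le> 1 - 1 / (2 * real N)" using N by (simp add: field_simps)
  then have eps: "0 \<le> \<epsilon>" by (simp add: \<epsilon>_def)
  have H: "0 \<le> H" using cluster_height_Omega(3)[OF N A] h by (simp add: H_def)
  obtain vs where vs: "length vs = cluster_size A" "set vs = {(x, y) \<in> A. y > 0}"
    "\<And>t. idla_pmf N t A = idla_pmf N t (Rle N 0) \<bind> add_particles N vs"
    using idla_pmf_decompose[OF N A] by blast
  obtain vs' where vs': "length vs' = cluster_size A'" "set vs' = {(x, y) \<in> A'. y > 0}"
    "\<And>t. idla_pmf N t A' = idla_pmf N t (Rle N 0) \<bind> add_particles N vs'"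
    using idla_pmf_decompose[OF N A'] by blast
  have low: "v \<in> cyl N \<and> snd v + int L \<le> H" if "v \<in> set vs" for v
  proof -
    have v: "v \<in> A" using that vs(2) by auto
    then have "snd v \<le> cluster_height A" using cluster_height_Omega(2)[OF N A, of "fst v" "snd v"] by simp
    then show ?thesis using v Omega_subset_cyl[OF A] h by (auto simp: H_def)
  qed
  have low': "v \<in> cyl N \<and> snd v + int L \<le> H" if "v \<in> set vs'" for v
  proof -
    have v: "v \<in> A'" using that vs'(2) by auto
    then have "snd v \<le> cluster_height A'" using cluster_height_Omega(2)[OF N A', of "fst v" "snd v"] by simp
    then show ?thesis using v Omega_subset_cyl[OF A'] h by (auto simp: H_def)
  qed
  define F where "F ws B = measure_pmf.prob (add_particles N ws B) S" for ws B
  have F01: "0 \<le> F ws B" "F ws B \<le> 1" for ws B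
    by (simp_all add: F_def measure_nonneg measure_pmf.prob_le_1)
  then have F_bdd: "\<bar>F ws B\<bar> \<le> 1" for ws B by simp
  have int: "integrable P (F ws)" for ws by (rule integrable_bounded_pmf[OF F_bdd])
  let ?bad = "{B. \<not> Rle N H \<subseteq> B}"
  have bad: "integrable P (indicator ?bad :: _ \<Rightarrow> real)"
    by (rule integrable_bounded_pmf[where M = 1]) (simp add: indicator_def)
  have "\<bar>measure_pmf.prob (idla_pmf N t A) S - measure_pmf.prob (idla_pmf N t A') S\<bar>
      = \<bar>measure_pmf.expectation P (\<lambda>B. F vs B - F vs' B)\<bar>"
    using int by (simp add: vs(3) vs'(3) P_def prob_bind_pmf F_def[abs_def])
  also have "\<dots> \<le> measure_pmf.expectation P (\<lambda>B. \<bar>F vs B - F vs' B\<bar>)"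
    by (rule integral_abs_bound)
  also have "\<dots> \<le> measure_pmf.expectation P (\<lambda>B. indicator ?bad B + \<epsilon>)"
  proof (rule integral_mono_AE)
    show "integrable P (\<lambda>B. \<bar>F vs B - F vs' B\<bar>)" using int by simp
    show "integrable P (\<lambda>B. indicator ?bad B + \<epsilon>)" using bad by simp
    show "AE B in P. \<bar>F vs B - F vs' B\<bar> \<le> indicator ?bad B + \<epsilon>"
    proof (rule AE_pmfI)
      fix B assume "B \<in> set_pmf P"
      then have B: "B \<in> Omega N" using set_idla_pmf_Omega[OF N R0] by (simp add: P_def)
      show "\<bar>F vs B - F vs' B\<bar> \<le> indicator ?bad B + \<epsilon>"
      proof (cases "B \<in> ?bad")
        case True
        then show ?thesis using F01[of vs B] F01[of vs' B] eps by (simp add: abs_le_iff)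
      next
        case False
        then have "Rle N H \<subseteq> B" by simp
        moreover have "length vs = length vs'" using vs(1) vs'(1) size by simp
        ultimately have "\<bar>F vs B - F vs' B\<bar> \<le> \<epsilon>"
          unfolding F_def \<epsilon>_def vs(1)[symmetric]
          by (intro add_particles_close[OF N B]) (auto dest: low low')
        then show ?thesis using False by simp
      qed
    qed
  qed
  also have "\<dots> = measure_pmf.prob P ?bad + \<epsilon>" using bad by simp
  also have "measure_pmf.prob P ?bad \<le> real N * real_of_int H * exp (- T)"
    unfolding P_def using L t by (intro prob_not_filled[OF N _ H T]) (auto simp: H_def)
  finally show ?thesis by (simp add: \<epsilon>_def H_def)
qed

section \<open>Choice of constants\<close>

lemma cluster_size_le:
  assumes N: "N \<ge> 3" and A: "A \<in> Omega N"
  shows "real (cluster_size A) \<le> real_of_int (cluster_height A) * real N"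
proof -
  have "{(x, y) \<in> A. y > 0} \<subseteq> {0..<int N} \<times> {1..cluster_height A}"
    using cluster_height_Omega(2)[OF N A] Omega_subset_cyl[OF A] by (auto simp: cyl_def)
  then have "cluster_size A \<le> card ({0..<int N} \<times> {1..cluster_height A})"
    unfolding cluster_size_def by (intro card_mono finite_box)
  also have "\<dots> = N * nat (cluster_height A)" by simp
  finally have "real (cluster_size A) \<le> real (N * nat (cluster_height A))" by (rule of_nat_mono)
  then show ?thesis using cluster_height_Omega(3)[OF N A] by (simp add: mult.commute)
qed

lemma tv_dist_le:
  assumes "\<And>S. S \<in> sets P \<Longrightarrow> \<bar>measure P S - measure Q S\<bar> \<le> c"
  shows "tv_dist P Q \<le> c"
  unfolding tv_dist_def using assms sets.empty_sets by (intro cSUP_least) blast+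

lemma power_decay_le_powr:
  assumes N: "N \<ge> 3" and L: "a * real N * ln (real N) \<le> real L"
  shows "(1 - 1 / (2 * real N)) ^ L \<le> real N powr (- (a / 2))"
proof -
  have "(1 - 1 / (2 * real N)) ^ L \<le> exp (- 1 / (2 * real N)) ^ L"
    using exp_ge_add_one_self[of "- 1 / (2 * real N)"] N by (intro power_mono) (auto simp: field_simps)
  also have "\<dots> = exp (- (real L / (2 * real N)))"
    by (simp add: exp_of_nat_mult[symmetric])
  also have "\<dots> \<le> exp (- (a / 2 * ln (real N)))"
    using N L by (simp add: field_simps)
  also have "\<dots> = real N powr (- (a / 2))" using N by (simp add: powr_def)
  finally show ?thesis .
qed

theorem theorem1p5:
  fixes m :: nat and \<gamma> :: real
  assumes "\<gamma> > 0"
  shows "\<exists>d>0. \<exists>N0. \<forall>N\<ge>N0. N \<ge> 3 \<longrightarrow>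
    (\<forall>A0\<in>Omega N. \<forall>A0'\<in>Omega N.
       let h0 = max (cluster_height A0) (cluster_height A0');
           t = real_of_int h0 * real N + d * (real N)\<^sup>2 * ln (real N)
       in cluster_size A0 = cluster_size A0' \<longrightarrow> h0 \<le> int N ^ m \<longrightarrow>
          tv_dist (idla_law N A0 t) (idla_law N A0' t) \<le> real N powr (- \<gamma>))"
proof -
  \<comment> \<open>All constants depend on \<open>m\<close> and \<open>\<gamma>\<close> only. The
    depth \<open>L\<close>, about \<open>a * N * ln N\<close>, makes the mixing factor at most
    \<open>N\<close> to the power \<open>-(m + 6 + \<gamma>)\<close>, enough to absorb
    \<open>H \<le> N ^ (m + 3)\<close> and three further factors \<open>N\<close>. With
    \<open>T = b * ln N\<close> the union bound over at most \<open>N ^ (m + 4)\<close> sites leaves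
    exponent \<open>-\<gamma> - 1\<close>.\<close>
  define a where "a = 2 * (real m + 6 + \<gamma>)"
  define b where "b = real m + 5 + \<gamma>"
  \<comment> \<open>Per factor \<open>N\<close>, the excess time must cover
    \<open>9 * L + 8 + 8 * T\<close>, one \<open>L\<close> coming from \<open>H = h + L\<close>. The
    18 collects this 8, the 9 from rounding \<open>L\<close> up and 1 for rounding \<open>t\<close>
    down.\<close>
  define d where "d = 9 * a + 8 * b + 18"
  have a: "a > 0" and b: "b > 0" using assms by (simp_all add: a_def b_def add_pos_pos)
  then have d: "d > 0" by (simp add: d_def)
  have main: "tv_dist (idla_law N A t) (idla_law N A' t) \<le> real N powr (- \<gamma>)"
    if N0: "N \<ge> nat \<lceil>a + 2\<rceil>" and N: "N \<ge> 3" and A: "A \<in> Omega N" and A': "A' \<in> Omega N"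
      and h: "h = max (cluster_height A) (cluster_height A')"
      and t: "t = real_of_int h * real N + d * (real N)\<^sup>2 * ln (real N)"
      and size: "cluster_size A = cluster_size A'" and hm: "h \<le> int N ^ m"
    for N A A' h t
  proof -
    define X where "X = real N"
    have X: "X \<ge> 3" "X \<ge> a + 2" using N N0 by (simp_all add: X_def ceiling_le_iff nat_le_iff) linarith
    define l where "l = ln X"
    have "exp 1 \<le> X" using exp_le X by linarith
    then have l: "1 \<le> l" using X by (simp add: l_def ln_ge_iff)
    have lX: "l \<le> X" using ln_le_minus_one[of X] X by (simp add: l_def)
    define L where "L = nat \<lceil>a * X * l\<rceil>"
    have L_ge: "a * X * l \<le> real L" unfolding L_def by linarith
    have "0 \<le> a * X * l" using a X l by simp
    then have L_le: "real L \<le> a * X * l + 1" unfolding L_def by linarith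
    define Q where "Q = (1 - 1 / (2 * real N)) ^ L"
    have Q0: "0 \<le> Q" unfolding Q_def using N by (intro zero_le_power) (simp add: field_simps)
    have Q: "Q \<le> X powr (- (real m + 6 + \<gamma>))"
    proof -
      have "a / 2 = real m + 6 + \<gamma>" by (simp add: a_def)
      then show ?thesis
        using power_decay_le_powr[OF N, of a L] L_ge unfolding Q_def X_def l_def by metis
    qed
    have h0: "0 \<le> h" using h cluster_height_Omega(3)[OF N A] by simp
    have "real_of_int h \<le> real_of_int (int N ^ m)" using hm by (rule of_int_le_iff[THEN iffD2])
    then have hX: "real_of_int h \<le> X ^ m" by (simp add: X_def)
    have sqX: "sqrt X \<le> X"
      using X real_sqrt_le_mono[of X "X\<^sup>2"] by (simp add: power2_eq_square)
    have Xm: "X ^ m \<le> X ^ (m + 2)" "X ^ 2 \<le> X ^ (m + 2)" "1 \<le> X ^ (m + 2)"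
      using X by (intro power_increasing one_le_power; simp)+
    \<comment> \<open>Here \<open>N \<ge> a + 2\<close> absorbs the constant into one more power of
      \<open>N\<close>.\<close>
    have HX: "real_of_int (h + int L) \<le> X ^ (m + 3)"
    proof -
      have "a * X * l \<le> a * X * X" using a X lX by (intro mult_left_mono) auto
      also have "\<dots> = a * X ^ 2" by (simp add: power2_eq_square)
      also have "\<dots> \<le> a * X ^ (m + 2)" using a Xm by (intro mult_left_mono) auto
      finally have "real_of_int (h + int L) \<le> X ^ (m + 2) + (a * X ^ (m + 2) + X ^ (m + 2))"
        using hX L_le Xm by simp
      also have "\<dots> = (a + 2) * X ^ (m + 2)" by (simp add: algebra_simps)
      also have "\<dots> \<le> X * X ^ (m + 2)" using X by (intro mult_right_mono) auto
      finally show ?thesis by (simp add: eval_nat_numeral)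
    qed
    have powr_X: "X ^ j * X powr s = X powr (real j + s)" for j s
      using X by (simp add: powr_add powr_realpow)
    have cond: "2 * real N * sqrt (real N) * (1 - 1 / (2 * real N)) ^ L * real_of_int (h + int L) \<le> 1"
    proof -
      have "2 * X * sqrt X * Q * real_of_int (h + int L)
          \<le> X * X * X * X powr (- (real m + 6 + \<gamma>)) * X ^ (m + 3)"
        using X sqX Q Q0 HX h0 by (intro mult_mono) auto
      also have "\<dots> = X ^ (m + 6) * X powr (- (real m + 6 + \<gamma>))"
        by (simp add: power_add eval_nat_numeral)
      also have "\<dots> = X powr (- \<gamma>)" by (simp add: powr_X)
      also have "\<dots> \<le> X powr 0" using X assms by (intro powr_mono) auto
      finally show ?thesis using X by (simp add: X_def Q_def)
    qed
    define T where "T = b * l"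
    have T: "0 \<le> T" using b l by (simp add: T_def)
    have time: "real_of_int (h + int L) * real N + 8 * real N * (real L + 1 + T) \<le> real (nat \<lfloor>t\<rfloor>)"
    proof -
      have "9 * real L + 8 + 8 * T + 1 \<le> 9 * (a * X * l) + 18 + 8 * (b * l)"
        using L_le by (simp add: T_def)
      also have "\<dots> \<le> 9 * (a * X * l) + 18 * (X * l) + 8 * (b * (X * l))"
      proof (intro add_mono mult_left_mono)
        have "1 * 1 \<le> X * l" using X l by (intro mult_mono) auto
        then show "18 \<le> 18 * (X * l)" by simp
        show "l \<le> X * l" using X l by simp
      qed (use a b X in auto)
      also have "\<dots> = d * X * l" by (simp add: d_def algebra_simps)
      finally have "X * (9 * real L + 8 + 8 * T + 1) \<le> X * (d * X * l)"
        using X by (intro mult_left_mono) auto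
      then have "real_of_int (h + int L) * X + 8 * X * (real L + 1 + T) \<le> t - 1"
        using X by (simp add: t X_def[symmetric] l_def[symmetric] power2_eq_square algebra_simps)
      then show ?thesis unfolding X_def by linarith
    qed
    have expT: "exp (- T) = X powr (- b)" using X by (simp add: T_def l_def powr_def)
    \<comment> \<open>The spare factor \<open>1 / N\<close> lets each of the two error terms take
      half of the final bound.\<close>
    have half: "X powr (- \<gamma> - 1) \<le> X powr (- \<gamma>) / 2"
    proof -
      have "X powr (- \<gamma> - 1) = X powr (- \<gamma>) / X" using X by (simp add: powr_diff)
      also have "\<dots> \<le> X powr (- \<gamma>) / 2" using X by (intro divide_left_mono) auto
      finally show ?thesis .
    qed
    have "real N * real_of_int (h + int L) * exp (- T) \<le> X * X ^ (m + 3) * X powr (- b)"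
      unfolding X_def[symmetric] expT using X HX by (intro mult_right_mono mult_left_mono) auto
    also have "\<dots> = X ^ (m + 4) * X powr (- b)" by (simp add: eval_nat_numeral)
    also have "\<dots> = X powr (- \<gamma> - 1)" 
      unfolding powr_X by (rule arg_cong[where f = "(powr) X"]) (simp add: b_def)
    finally have e1: "real N * real_of_int (h + int L) * exp (- T) \<le> X powr (- \<gamma>) / 2"
      using half by linarith
    have "real_of_int (cluster_height A) \<le> X ^ m" using hX h by simp
    then have "real_of_int (cluster_height A) * X \<le> X ^ m * X" using X by (intro mult_right_mono) auto
    then have n_le: "real (cluster_size A) \<le> X ^ m * X"
      using cluster_size_le[OF N A] by (simp add: X_def)
    have "4 \<le> X * X" using X mult_mono[of 2 X 2 X] by simp
    then have "real (cluster_size A) * (4 * sqrt X * Q)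
        \<le> X ^ m * X * (X * X * X * X powr (- (real m + 6 + \<gamma>)))"
      using n_le X sqX Q Q0 by (intro mult_mono) auto
    also have "\<dots> = X ^ (m + 4) * X powr (- (real m + 6 + \<gamma>))"
      by (simp add: power_add eval_nat_numeral)
    also have "\<dots> = X powr (- \<gamma> - 2)"
      unfolding powr_X by (rule arg_cong[where f = "(powr) X"]) simp
    also have "\<dots> \<le> X powr (- \<gamma> - 1)" using X by (intro powr_mono) auto
    finally have e2: "real (cluster_size A) * (4 * sqrt (real N) * (1 - 1 / (2 * real N)) ^ L)
        \<le> X powr (- \<gamma>) / 2"
      using half by (simp add: X_def Q_def)
    show ?thesis
    proof (rule tv_dist_le)
      fix S assume "S \<in> sets (idla_law N A t)"
      then have S: "S \<subseteq> Omega N" by (simp add: idla_law_def)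
      have "\<bar>measure_pmf.prob (idla_pmf N (nat \<lfloor>t\<rfloor>) A) S - measure_pmf.prob (idla_pmf N (nat \<lfloor>t\<rfloor>) A') S\<bar>
          \<le> real N * real_of_int (h + int L) * exp (- T)
            + real (cluster_size A) * (4 * sqrt (real N) * (1 - 1 / (2 * real N)) ^ L)"
        using h by (intro prob_idla_pmf_close[OF N A A' size _ _ cond T time]) auto
      then show "\<bar>measure (idla_law N A t) S - measure (idla_law N A' t) S\<bar> \<le> real N powr (- \<gamma>)"
        using e1 e2 by (simp add: measure_idla_law[OF N _ S] A A' X_def)
    qed
  qed
  show ?thesis
    by (intro exI[of _ d] conjI d exI[of _ "nat \<lceil>a + 2\<rceil>"] allI impI ballI, unfold Let_def)
       (intro impI main[OF _ _ _ _ refl refl]; assumption)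
qed

end
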